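(* For every integer $m\ge 4$, let $N_m$ be the largest real root of the polynomial (in the variable $n$) $$\begin{aligned}\gamma_m(n):=\;&n^5-19(m-1)n^4+(117m^2-212m+92)n^3-(337m^3-851m^2+652m-140)n^2\\&+2(m-1)(241m^3-518m^2+264m-24)n-4m(m-1)(70m^3-187m^2+133m-24).\end{aligned}$$ Then for every integer $m\ge 4$ and every integer $n>N_m$, there exists a conformally Euclidean metric $g=\varphi^2|dx|^2$ on $\mathbb{R}^n$ ($\varphi$ smooth and positive on $\mathbb{R}^n$) such that $Q_g^{(6)}(0)<0$ and $C^{-1}\le Q_g^{(2m)}\le C$ in $\mathbb{R}^n$ for some constant $C>0$, and such that, additionally, by stereographic projection, $g$ extends to a smooth metric on $\mathbb{S}^n$ (that is, the pullback of $g$ to $\mathbb{S}^n\setminus\{x_0\}$ by the stereographic projection $\mathbb{S}^n\setminus\{x_0\}\to\mathbb{R}^n$ from a pole $x_0\in\mathbb{S}^n$ extends to a smooth Riemannian metric on $\mathbb{S}^n$). Furthermore, $N_m\sim\Lambda m$ as $m\to\infty$ (that is, $N_m/(\Lambda m)\to 1$) and $N_m<\Lambda m$ for all integers $m\ge 4$, where $\Lambda\simeq 10.55$ is the largest real root of the polynomial $X^4-17X^3+83X^2-171X+140$.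
   Context: Here $|dx|^2$ is the Euclidean metric and $\Delta=\sum_i\partial_i^2$ is the Euclidean Laplacian on $\mathbb{R}^n$. For a conformally Euclidean metric $g=\varphi^2|dx|^2$ on $\mathbb{R}^n$ ($\varphi$ smooth and positive) and every positive integer $k$ with $n\ge 2k$, the $Q$-curvature of order $2k$ of $g$ is $$Q_g^{(2k)}=\begin{cases}\dfrac{2}{n-2k}\,\varphi^{-\frac{n+2k}{2}}(-\Delta)^k\big(\varphi^{\frac{n-2k}{2}}\big)&\text{if }n>2k,\\[2mm]\varphi^{-n}(-\Delta)^k(\ln\varphi)&\text{if }n=2k.\end{cases}$$ $\mathbb{S}^n$ denotes the standard unit sphere of dimension $n$. *)

theory Defs
  imports "HOL-Analysis.Analysis" "HOL-Computational_Algebra.Polynomial"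
begin

section \<open>Smooth functions\<close>

definition dir_deriv ::
  "'a::real_normed_vector \<Rightarrow> ('a \<Rightarrow> 'b::real_normed_vector) \<Rightarrow> 'a \<Rightarrow> 'b" where
  "dir_deriv v f x = frechet_derivative f (at x) v"

text \<open>The class \<open>C\<^sup>k\<close>; to be used on open sets of a finite-dimensional space, since the
  derivatives are taken in the whole space.\<close>

primrec Ck_on ::
  "nat \<Rightarrow> 'a::real_normed_vector set \<Rightarrow> ('a \<Rightarrow> 'b::real_normed_vector) \<Rightarrow> bool" where
  "Ck_on 0 U f \<longleftrightarrow> continuous_on U f"
| "Ck_on (Suc k) U f \<longleftrightarrow>
     (\<forall>x\<in>U. f differentiable (at x)) \<and> (\<forall>v. Ck_on k U (dir_deriv v f))"

definition Cinf_on :: "'a::real_normed_vector set \<Rightarrow> ('a \<Rightarrow> 'b::real_normed_vector) \<Rightarrow> bool" where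
  "Cinf_on U f \<longleftrightarrow> (\<forall>k. Ck_on k U f)"

text \<open>Smoothness on an arbitrary subset, in particular on an embedded submanifold such as the
  sphere: near every point the function is the restriction of a smooth function on an open set
  of the ambient space.\<close>

definition smooth_on_subset ::
  "'a::real_normed_vector set \<Rightarrow> ('a \<Rightarrow> 'b::real_normed_vector) \<Rightarrow> bool" where
  "smooth_on_subset S f \<longleftrightarrow>
     (\<forall>x\<in>S. \<exists>U F. open U \<and> x \<in> U \<and> Cinf_on U F \<and> (\<forall>y\<in>S \<inter> U. F y = f y))"

section \<open>The \<open>Q\<close>-curvatures of a conformally Euclidean metric\<close>

definition laplacian :: "('a::euclidean_space \<Rightarrow> real) \<Rightarrow> 'a \<Rightarrow> real" where
  "laplacian f x = (\<Sum>b\<in>Basis. dir_deriv b (dir_deriv b f) x)"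

definition neg_laplacian_pow :: "nat \<Rightarrow> ('a::euclidean_space \<Rightarrow> real) \<Rightarrow> 'a \<Rightarrow> real" where
  "neg_laplacian_pow k f = ((\<lambda>u x. - laplacian u x) ^^ k) f"

text \<open>\<open>Q_curvature k \<phi>\<close> is the \<open>Q\<close>-curvature of order \<open>2k\<close> (not of order \<open>k\<close>) of the metric
  \<open>\<phi>\<^sup>2 |dx|\<^sup>2\<close>. It is only meaningful when \<open>2k\<close> is at most the dimension.\<close>

definition Q_curvature :: "nat \<Rightarrow> ('a::euclidean_space \<Rightarrow> real) \<Rightarrow> 'a \<Rightarrow> real" where
  "Q_curvature k \<phi> x =
     (let n = real DIM('a) in
      if DIM('a) > 2 * k then
        2 / (n - 2 * real k) * \<phi> x powr (- (n + 2 * real k) / 2) *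
          neg_laplacian_pow k (\<lambda>y. \<phi> y powr ((n - 2 * real k) / 2)) x
      else if DIM('a) = 2 * k then
        \<phi> x powr (- n) * neg_laplacian_pow k (\<lambda>y. ln (\<phi> y)) x
      else undefined)"

section \<open>Metrics on the sphere and stereographic projection\<close>

text \<open>The ambient space of the sphere \<open>S\<^sup>n\<close> is \<open>\<real>\<^sup>n \<times> \<real>\<close> with its product inner product, the pole
  is \<open>(0, 1)\<close>, and the projection is onto the equatorial hyperplane.\<close>

definition pole :: "'a::euclidean_space \<times> real" where
  "pole = (0, 1)"

definition stereographic :: "'a::euclidean_space \<times> real \<Rightarrow> 'a" where
  "stereographic p = fst p /\<^sub>R (1 - snd p)"

definition tangent_sphere :: "'b::real_inner \<Rightarrow> 'b set" where
  "tangent_sphere p = {v. p \<bullet> v = 0}"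

definition inner_product_on :: "'b::real_vector set \<Rightarrow> ('b \<Rightarrow> 'b \<Rightarrow> real) \<Rightarrow> bool" where
  "inner_product_on V B \<longleftrightarrow>
     (\<forall>u\<in>V. \<forall>v\<in>V. B u v = B v u) \<and>
     (\<forall>u\<in>V. \<forall>v\<in>V. \<forall>w\<in>V. B (u + v) w = B u w + B v w) \<and>
     (\<forall>c. \<forall>u\<in>V. \<forall>v\<in>V. B (c *\<^sub>R u) v = c * B u v) \<and>
     (\<forall>u\<in>V. u \<noteq> 0 \<longrightarrow> B u u > 0)"

definition smooth_tangent_field :: "('b::euclidean_space \<Rightarrow> 'b) \<Rightarrow> bool" where
  "smooth_tangent_field X \<longleftrightarrow>
     smooth_on_subset (sphere 0 1) X \<and> (\<forall>p\<in>sphere 0 1. X p \<in> tangent_sphere p)"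

text \<open>Only the values \<open>h p u v\<close> with \<open>p\<close> on the sphere and \<open>u\<close>, \<open>v\<close> tangent at \<open>p\<close> matter.\<close>

definition smooth_sphere_metric :: "('b::euclidean_space \<Rightarrow> 'b \<Rightarrow> 'b \<Rightarrow> real) \<Rightarrow> bool" where
  "smooth_sphere_metric h \<longleftrightarrow>
     (\<forall>p\<in>sphere 0 1. inner_product_on (tangent_sphere p) (h p)) \<and>
     (\<forall>X Y. smooth_tangent_field X \<longrightarrow> smooth_tangent_field Y \<longrightarrow>
        smooth_on_subset (sphere 0 1) (\<lambda>p. h p (X p) (Y p)))"

definition conf_metric :: "('a::euclidean_space \<Rightarrow> real) \<Rightarrow> 'a \<Rightarrow> 'a \<Rightarrow> 'a \<Rightarrow> real" where
  "conf_metric \<phi> x u v = (\<phi> x)\<^sup>2 * (u \<bullet> v)"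

text \<open>The differential of the projection restricted to the sphere is the restriction to the
  tangent space of the differential of \<open>stereographic\<close>, which is smooth on the ambient open set
  of all \<open>p\<close> with \<open>snd p \<noteq> 1\<close>.\<close>

definition stereographic_pullback ::
  "('a::euclidean_space \<Rightarrow> 'a \<Rightarrow> 'a \<Rightarrow> real)
     \<Rightarrow> 'a \<times> real \<Rightarrow> 'a \<times> real \<Rightarrow> 'a \<times> real \<Rightarrow> real" where
  "stereographic_pullback g p u v =
     g (stereographic p)
       (frechet_derivative stereographic (at p) u)
       (frechet_derivative stereographic (at p) v)"

definition extends_to_sphere :: "('a::euclidean_space \<Rightarrow> 'a \<Rightarrow> 'a \<Rightarrow> real) \<Rightarrow> bool" where
  "extends_to_sphere g \<longleftrightarrow>
     (\<exists>h. smooth_sphere_metric h \<and>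
       (\<forall>p\<in>sphere 0 1 - {pole}. \<forall>u\<in>tangent_sphere p. \<forall>v\<in>tangent_sphere p.
          h p u v = stereographic_pullback g p u v))"

section \<open>The polynomials and their largest real roots\<close>

definition largest_real_root :: "real poly \<Rightarrow> real" where
  "largest_real_root p = Max {x. poly p x = 0}"

definition gamma_poly :: "nat \<Rightarrow> real poly" where
  "gamma_poly m =
     (let \<mu> = real m in
      [: - 4 * \<mu> * (\<mu> - 1) * (70 * \<mu>^3 - 187 * \<mu>^2 + 133 * \<mu> - 24),
         2 * (\<mu> - 1) * (241 * \<mu>^3 - 518 * \<mu>^2 + 264 * \<mu> - 24),
         - (337 * \<mu>^3 - 851 * \<mu>^2 + 652 * \<mu> - 140),
         117 * \<mu>^2 - 212 * \<mu> + 92,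
         - 19 * (\<mu> - 1),
         1 :])"

definition N_root :: "nat \<Rightarrow> real" where
  "N_root m = largest_real_root (gamma_poly m)"

definition Lambda_const :: real where
  "Lambda_const = largest_real_root [: 140, - 171, 83, - 17, 1 :]"

text \<open>These largest roots exist.\<close>

lemma largest_real_root:
  assumes "p \<noteq> 0" and "poly p r = 0"
  shows "poly p (largest_real_root p) = 0"
    and "poly p x = 0 \<Longrightarrow> x \<le> largest_real_root p"
proof -
  have fin: "finite {x. poly p x = 0}"
    using assms(1) by (rule poly_roots_finite)
  have "largest_real_root p \<in> {x. poly p x = 0}"
    unfolding largest_real_root_def using fin assms(2) by (intro Max_in) auto
  then show "poly p (largest_real_root p) = 0"
    by simp
  show "poly p x = 0 \<Longrightarrow> x \<le> largest_real_root p"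
    unfolding largest_real_root_def using fin by (intro Max_ge) auto
qed

lemma real_poly_root_above:
  fixes p :: "real poly"
  assumes "poly p a < 0" and "lead_coeff p > 0"
  shows "\<exists>r. poly p r = 0"
proof -
  obtain b where b: "\<forall>x\<ge>b. lead_coeff p \<le> poly p x"
    using poly_pinfty_gt_lc[OF assms(2)] by blast
  then have "poly p (max b (a + 1)) > 0"
    using assms(2) by (meson less_le_trans max.cobounded1)
  then show ?thesis
    using poly_IVT_pos[of a "max b (a + 1)" p] assms(1) by force
qed

lemma N_root:
  assumes "m \<ge> 4"
  shows "poly (gamma_poly m) (N_root m) = 0"
    and "poly (gamma_poly m) x = 0 \<Longrightarrow> x \<le> N_root m"
proof -
  have m: "real m \<ge> 4"
    using assms by simp
  have "70 * real m ^ 3 - 187 * (real m)\<^sup>2 + 133 * real m - 24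
      = (real m)\<^sup>2 * (70 * real m - 187) + (133 * real m - 24)"
    by (simp add: algebra_simps power2_eq_square power3_eq_cube)
  also have "\<dots> > 0"
    using m by (intro add_nonneg_pos mult_nonneg_nonneg) auto
  finally have "poly (gamma_poly m) 0 < 0"
    using m by (simp add: gamma_poly_def Let_def mult_less_0_iff zero_less_mult_iff)
  moreover have "lead_coeff (gamma_poly m) > 0"
    by (simp add: gamma_poly_def Let_def)
  ultimately obtain r where r: "poly (gamma_poly m) r = 0"
    using real_poly_root_above by blast
  have nz: "gamma_poly m \<noteq> 0"
    by (simp add: gamma_poly_def Let_def)
  show "poly (gamma_poly m) (N_root m) = 0"
    and "poly (gamma_poly m) x = 0 \<Longrightarrow> x \<le> N_root m"
    unfolding N_root_def using largest_real_root[OF nz r] by blast+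
qed

lemma Lambda_const:
  shows "poly [: 140, - 171, 83, - 17, 1 :] Lambda_const = 0"
    and "poly [: 140, - 171, 83, - 17, 1 :] x = 0 \<Longrightarrow> x \<le> Lambda_const"
proof -
  have "poly [: 140, - 171, 83, - 17, 1 :] (10 :: real) < 0"
    by simp
  then obtain r where r: "poly [: 140, - 171, 83, - 17, 1 :] (r :: real) = 0"
    using real_poly_root_above by fastforce
  show "poly [: 140, - 171, 83, - 17, 1 :] Lambda_const = 0"
    and "poly [: 140, - 171, 83, - 17, 1 :] x = 0 \<Longrightarrow> x \<le> Lambda_const"
    unfolding Lambda_const_def using largest_real_root[OF _ r] by simp_all
qed

end

theory Submission
  imports Defs
begin

text \<open>
  Put \<open>n\<close> for the dimension, \<open>l = n/2 - m\<close>, and for a point \<open>y\<close> of the open unit ball let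
  \<open>q\<^sub>y(x) = |x - y|\<^sup>2 + 1 - |y|\<^sup>2\<close>. The bubble \<open>q\<^sub>y\<^sup>-\<^sup>l\<close> satisfies
  \<open>(-\<Delta>)\<^sup>m q\<^sub>y\<^sup>-\<^sup>l = c q\<^sub>y powr (-n/2 - m)\<close> with \<open>c > 0\<close> (lemma \<open>neg_laplacian_pow_bubble\<close>). The metric is built
  from an average \<open>u\<close> of finitely many bubbles, \<open>\<phi> = u powr (1/l)\<close>. Because \<open>(-\<Delta>)\<^sup>m\<close> is linear
  and any two of the functions \<open>q\<^sub>y\<close> are comparable, the curvature of order \<open>2m\<close> lies between two
  positive constants. Because \<open>q\<^sub>y\<close> becomes, under the stereographic projection, a positive affine
  function on the sphere divided by the conformal factor, the metric extends smoothly to the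
  sphere. Both facts hold for all choices of the centres, which remain free for the third
  condition.

  The sign of \<open>Q\<^sup>(\<^sup>6\<^sup>)(0)\<close> is that of \<open>(-\<Delta>)\<^sup>3(u\<^sup>a)(0)\<close> with \<open>a = (n - 6)/(n - 2m) > 1\<close>. One bubble gives
  the round metric, for which this is positive. What can make it negative is the cubic part
  \<open>u\<^sub>3\<close> of the Taylor expansion of \<open>u\<close>, since \<open>u\<^sup>a\<close> contains \<open>a(a-1)/2 u\<^sub>3\<^sup>2\<close> and
  \<open>\<Delta>\<^sup>3(u\<^sub>3\<^sup>2) > 0\<close> unless \<open>u\<^sub>3 = 0\<close>.
  So the centres should have large third moments while their other moments stay small and spread over
  several directions: they are taken at the vertices of a regular simplex centred at the origin,
  almost on the unit sphere. With nine vertices, in the limit in which they reach the unit sphere,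
  the value is \<open>- (n - 6)(m - 3) P(m, n)\<close> with an explicit quartic polynomial \<open>P\<close>
  (\<open>simplex_value_regular\<close>), and \<open>P > 0\<close> as soon as \<open>n \<ge> 10 m - 11\<close>.

  The computation is finite for two reasons. First, \<open>u - 1\<close> vanishes to second order at the
  origin, so only the binomial coefficients of \<open>a\<close> up to the third contribute
  (\<open>neg_laplacian_pow_3_powr\<close>). Second, the gradients satisfy
  \<open>\<nabla>q\<^sub>y \<bullet> \<nabla>q\<^sub>z = 2 q\<^sub>y + 2 q\<^sub>z - 2 (2 - 2 y \<bullet> z)\<close>, so the Laplacian maps monomials
  in the functions \<open>q\<^sub>y\<close> to combinations of such monomials (\<open>laplacian_quad_monomial\<close>), and at the origin
  all these monomials are 1.

  Finally \<open>\<gamma>\<^sub>m(10 m - 11) < 0\<close>, so that \<open>n > N\<^sub>m\<close> implies \<open>n > 10 m - 11\<close>. The statements on the size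
  of \<open>N\<^sub>m\<close> come from the expansion of \<open>\<gamma>\<^sub>m(X m)\<close> in powers of \<open>m\<close>: its leading
  coefficient is \<open>X - 2\<close> times the quartic polynomial that defines \<open>\<Lambda>\<close>, and the lower ones are positive
  for \<open>X \<ge> \<Lambda>\<close>.
\<close>

section \<open>Calculus of smooth functions\<close>

lemma dir_deriv_eq: "(f has_derivative f') (at x) \<Longrightarrow> dir_deriv v f x = f' v"
  by (simp add: dir_deriv_def frechet_derivative_at[symmetric])

lemma differentiable_has_dir_deriv:
  "f differentiable (at x) \<Longrightarrow> (f has_derivative (\<lambda>v. dir_deriv v f x)) (at x)"
  by (simp add: dir_deriv_def frechet_derivative_works[symmetric])

lemma Ck_on_continuous: "Ck_on k U f \<Longrightarrow> continuous_on U f"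
  by (cases k) (auto intro: differentiable_imp_continuous_on differentiable_on_subset
      simp: differentiable_on_def differentiable_at_withinI)

lemma Ck_on_Suc_D: "Ck_on (Suc k) U f \<Longrightarrow> Ck_on k U f"
proof (induction k arbitrary: f)
  case 0
  then show ?case using Ck_on_continuous by (simp del: Ck_on.simps(2) add: Ck_on_continuous)
next
  case (Suc k)
  then show ?case by auto
qed

text \<open>Openness matters: derivatives are taken in the whole space, so agreement on a set determines them
  only in its interior.\<close>

lemma Ck_on_cong:
  assumes "open U" and "\<And>x. x \<in> U \<Longrightarrow> f x = g x" and "Ck_on k U f"
  shows "Ck_on k U g"
  using assms(2,3)
proof (induction k arbitrary: f g)
  case 0
  then show ?case by (simp cong: continuous_on_cong)
next
  case (Suc k)
  have der: "(g has_derivative frechet_derivative f (at x)) (at x)" if "x \<in> U" for x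
  proof (rule has_derivative_transform_within_open[of f _ x UNIV U])
    show "(f has_derivative frechet_derivative f (at x)) (at x)"
      using Suc.prems(2) that by (simp add: frechet_derivative_works[symmetric])
  qed (use that assms(1) Suc.prems(1) in auto)
  have "Ck_on k U (dir_deriv v g)" for v
  proof (rule Suc.IH)
    show "dir_deriv v f x = dir_deriv v g x" if "x \<in> U" for x
      using dir_deriv_eq[OF der[OF that]] by (simp add: dir_deriv_def)
    show "Ck_on k U (dir_deriv v f)" using Suc.prems(2) by simp
  qed
  then show ?case using der by (auto simp: differentiable_def)
qed

lemma Ck_on_subset: "Ck_on k U f \<Longrightarrow> V \<subseteq> U \<Longrightarrow> Ck_on k V f"
  by (induction k arbitrary: f) (auto intro: continuous_on_subset)

text \<open>A coinductive characterisation of smoothness, which avoids the index \<open>k\<close> from here on.\<close>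

lemma Cinf_on_iff:
  "Cinf_on U f \<longleftrightarrow> (\<forall>x\<in>U. f differentiable (at x)) \<and> (\<forall>v. Cinf_on U (dir_deriv v f))"
proof
  assume "Cinf_on U f"
  then have "Ck_on (Suc k) U f" for k by (simp add: Cinf_on_def del: Ck_on.simps)
  then show "(\<forall>x\<in>U. f differentiable (at x)) \<and> (\<forall>v. Cinf_on U (dir_deriv v f))"
    by (auto simp: Cinf_on_def)
next
  assume "(\<forall>x\<in>U. f differentiable (at x)) \<and> (\<forall>v. Cinf_on U (dir_deriv v f))"
  then have "Ck_on (Suc k) U f" for k by (auto simp: Cinf_on_def)
  then show "Cinf_on U f" unfolding Cinf_on_def using Ck_on_Suc_D by blast
qed

lemma Cinf_on_dir_deriv: "Cinf_on U f \<Longrightarrow> Cinf_on U (dir_deriv v f)"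
  using Cinf_on_iff by blast

lemma Cinf_on_has_derivative:
  "Cinf_on U f \<Longrightarrow> x \<in> U \<Longrightarrow> (f has_derivative (\<lambda>v. dir_deriv v f x)) (at x)"
  by (subst (asm) Cinf_on_iff) (simp add: differentiable_has_dir_deriv)

lemma Cinf_on_subset: "Cinf_on U f \<Longrightarrow> V \<subseteq> U \<Longrightarrow> Cinf_on V f"
  unfolding Cinf_on_def using Ck_on_subset by blast

lemma Cinf_on_const [simp]: "Cinf_on U (\<lambda>x. c)"
proof -
  have "Ck_on k U (\<lambda>x. c)" for k and c :: 'b
  proof (induction k arbitrary: c)
    case (Suc k)
    have "dir_deriv v (\<lambda>x::'a. c) = (\<lambda>x. 0)" for v
      by (rule ext, rule dir_deriv_eq) (rule has_derivative_const)
    with Suc show ?case by simp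
  qed simp
  then show ?thesis by (simp add: Cinf_on_def)
qed

lemma Cinf_on_bounded_linear: "bounded_linear f \<Longrightarrow> Cinf_on U f"
proof (subst Cinf_on_iff, intro conjI ballI allI)
  assume f: "bounded_linear f"
  then have der: "(f has_derivative f) (at x)" for x by (rule bounded_linear_imp_has_derivative)
  then show "f differentiable (at x)" for x by (auto simp: differentiable_def)
  have "dir_deriv v f = (\<lambda>x. f v)" for v using dir_deriv_eq[OF der] by auto
  then show "Cinf_on U (dir_deriv v f)" for v by simp
qed

lemma Ck_on_add:
  assumes U: "open U" and "Ck_on k U f" "Ck_on k U g"
  shows "Ck_on k U (\<lambda>x. f x + g x)"
  using assms(2,3)
proof (induction k arbitrary: f g)
  case (Suc k)
  have der: "((\<lambda>x. f x + g x) has_derivative (\<lambda>v. dir_deriv v f x + dir_deriv v g x)) (at x)"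
    if "x \<in> U" for x
    using Suc.prems that by (intro has_derivative_add differentiable_has_dir_deriv) auto
  have "Ck_on k U (dir_deriv v (\<lambda>x. f x + g x))" for v
  proof (rule Ck_on_cong[OF U])
    show "Ck_on k U (\<lambda>x. dir_deriv v f x + dir_deriv v g x)"
      using Suc.prems by (intro Suc.IH) auto
  qed (simp add: dir_deriv_eq[OF der])
  then show ?case using der by (auto simp: differentiable_def)
qed (auto intro: continuous_intros)

lemma Cinf_on_add:
  "open U \<Longrightarrow> Cinf_on U f \<Longrightarrow> Cinf_on U g \<Longrightarrow> Cinf_on U (\<lambda>x. f x + g x)"
  unfolding Cinf_on_def using Ck_on_add by blast

text \<open>The product rule expresses a derivative by products of the same kind of one order less. Bilinear maps
  cover products of real functions and inner products of vector fields at once.\<close>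

lemma Ck_on_bilinear:
  assumes B: "bounded_bilinear B" and U: "open U" and "Ck_on k U f" "Ck_on k U g"
  shows "Ck_on k U (\<lambda>x. B (f x) (g x))"
  using assms(3,4)
proof (induction k arbitrary: f g)
  case 0
  then show ?case by (simp add: bounded_bilinear.continuous_on[OF B])
next
  case (Suc k)
  have der: "((\<lambda>x. B (f x) (g x)) has_derivative
      (\<lambda>v. B (f x) (dir_deriv v g x) + B (dir_deriv v f x) (g x))) (at x)" if "x \<in> U" for x
    using Suc.prems that by (intro bounded_bilinear.FDERIV[OF B] differentiable_has_dir_deriv) auto
  have "Ck_on k U (dir_deriv v (\<lambda>x. B (f x) (g x)))" for v
  proof (rule Ck_on_cong[OF U])
    show "Ck_on k U (\<lambda>x. B (f x) (dir_deriv v g x) + B (dir_deriv v f x) (g x))"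
      using Suc.prems Suc.prems[THEN Ck_on_Suc_D] by (intro Ck_on_add[OF U] Suc.IH) auto
  qed (simp add: dir_deriv_eq[OF der])
  then show ?case using der by (auto simp: differentiable_def)
qed

lemma Cinf_on_bilinear:
  "bounded_bilinear B \<Longrightarrow> open U \<Longrightarrow> Cinf_on U f \<Longrightarrow> Cinf_on U g \<Longrightarrow> Cinf_on U (\<lambda>x. B (f x) (g x))"
  unfolding Cinf_on_def using Ck_on_bilinear by blast

lemmas Cinf_on_mult = Cinf_on_bilinear[OF bounded_bilinear_mult]
lemmas Cinf_on_inner = Cinf_on_bilinear[OF bounded_bilinear_inner]

lemma Cinf_on_cmult: "open U \<Longrightarrow> Cinf_on U f \<Longrightarrow> Cinf_on U (\<lambda>x. (c::real) * f x)"
  by (rule Cinf_on_mult) auto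

lemma Cinf_on_uminus: "open U \<Longrightarrow> Cinf_on U f \<Longrightarrow> Cinf_on U (\<lambda>x. - f x :: real)"
  using Cinf_on_cmult[of U f "-1"] by simp

lemma Cinf_on_diff:
  "open U \<Longrightarrow> Cinf_on U f \<Longrightarrow> Cinf_on U g \<Longrightarrow> Cinf_on U (\<lambda>x. f x - g x :: real)"
  using Cinf_on_add[OF _ _ Cinf_on_uminus, of U f g] by simp

lemma Cinf_on_sum:
  "open U \<Longrightarrow> (\<And>i. i \<in> I \<Longrightarrow> Cinf_on U (f i)) \<Longrightarrow> Cinf_on U (\<lambda>x. \<Sum>i\<in>I. f i x)"
  by (induction I rule: infinite_finite_induct) (auto intro: Cinf_on_add)

lemma has_derivative_powr_const:
  fixes f :: "'a::real_normed_vector \<Rightarrow> real"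
  assumes "(f has_derivative f') (at x)" and "f x > 0"
  shows "((\<lambda>x. f x powr a) has_derivative (\<lambda>v. a * f x powr (a - 1) * f' v)) (at x)"
proof -
  have "((\<lambda>t. t powr a) has_derivative (\<lambda>h. a * f x powr (a - 1) * h)) (at (f x))"
    using has_real_derivative_powr[OF assms(2), of a]
    by (simp add: has_field_derivative_def)
  from diff_chain_at[OF assms(1) this] show ?thesis by (simp add: o_def)
qed

lemma dir_deriv_powr:
  fixes f :: "'a::real_normed_vector \<Rightarrow> real"
  assumes "Cinf_on U f" and "x \<in> U" and "f x > 0"
  shows "dir_deriv v (\<lambda>x. f x powr a) x = a * (f x powr (a - 1) * dir_deriv v f x)"
  using dir_deriv_eq[OF has_derivative_powr_const[OF Cinf_on_has_derivative[OF assms(1,2)] assms(3)]]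
  by simp

text \<open>The exponent has to vary in the induction, because differentiation lowers it by one.\<close>

lemma Cinf_on_powr:
  fixes f :: "'a::real_normed_vector \<Rightarrow> real"
  assumes U: "open U" and f: "Cinf_on U f" and pos: "\<And>x. x \<in> U \<Longrightarrow> f x > 0"
  shows "Cinf_on U (\<lambda>x. f x powr a)"
proof -
  have der: "((\<lambda>x. f x powr a) has_derivative (\<lambda>v. a * f x powr (a - 1) * dir_deriv v f x)) (at x)"
    if "x \<in> U" for x a
    using has_derivative_powr_const Cinf_on_has_derivative[OF f] pos that by blast
  have "Ck_on k U (\<lambda>x. f x powr a)" for k a
  proof (induction k arbitrary: a)
    case 0
    have "continuous_on U f" using f Ck_on_continuous by (auto simp: Cinf_on_def)
    moreover have "f x \<noteq> 0" if "x \<in> U" for x using pos[OF that] by simp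
    ultimately show ?case by (auto intro!: continuous_on_powr continuous_on_const)
  next
    case (Suc k)
    show ?case
    proof (unfold Ck_on.simps, intro conjI ballI allI)
      show "(\<lambda>x. f x powr a) differentiable at x" if "x \<in> U" for x
        using der[OF that] by (auto simp: differentiable_def)
      fix v
      have "Ck_on k U (dir_deriv v f)" using Cinf_on_dir_deriv[OF f] by (simp add: Cinf_on_def)
      then have "Ck_on k U (\<lambda>x. a * (f x powr (a - 1) * dir_deriv v f x))"
        using Cinf_on_const[of U a] unfolding Cinf_on_def
        by (intro Ck_on_bilinear[OF bounded_bilinear_mult U] Suc.IH) auto
      then show "Ck_on k U (dir_deriv v (\<lambda>x. f x powr a))"
        by (rule Ck_on_cong[OF U, rotated]) (simp add: dir_deriv_powr[OF f _ pos])
    qed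
  qed
  then show ?thesis by (simp add: Cinf_on_def)
qed

section \<open>Powers of the Laplacian and vanishing at the origin\<close>

lemma dir_deriv_const [simp]: "dir_deriv v (\<lambda>x. c) = (\<lambda>x. 0)"
  by (rule ext, rule dir_deriv_eq) (rule has_derivative_const)

lemma dir_deriv_add:
  "Cinf_on UNIV f \<Longrightarrow> Cinf_on UNIV g \<Longrightarrow>
    dir_deriv v (\<lambda>x. f x + g x) = (\<lambda>x. dir_deriv v f x + dir_deriv v g x)"
  using dir_deriv_eq[OF has_derivative_add[OF Cinf_on_has_derivative[of UNIV] Cinf_on_has_derivative[of UNIV]]] by fastforce

lemma dir_deriv_mult:
  fixes f g :: "'a::real_normed_vector \<Rightarrow> real"
  shows "Cinf_on UNIV f \<Longrightarrow> Cinf_on UNIV g \<Longrightarrow>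
    dir_deriv v (\<lambda>x. f x * g x) = (\<lambda>x. f x * dir_deriv v g x + dir_deriv v f x * g x)"
  using dir_deriv_eq[OF has_derivative_mult[OF Cinf_on_has_derivative[of UNIV] Cinf_on_has_derivative[of UNIV]]] by fastforce

lemma dir_deriv_cmult:
  fixes f :: "'a::real_normed_vector \<Rightarrow> real"
  shows "Cinf_on UNIV f \<Longrightarrow> dir_deriv v (\<lambda>x. c * f x) = (\<lambda>x. c * dir_deriv v f x)"
  by (simp add: dir_deriv_mult)

lemma dir_deriv_sum:
  fixes f :: "'i \<Rightarrow> 'a::real_normed_vector \<Rightarrow> 'b::real_normed_vector"
  shows "(\<And>i. i \<in> I \<Longrightarrow> Cinf_on UNIV (f i)) \<Longrightarrow>
    dir_deriv v (\<lambda>x. \<Sum>i\<in>I. f i x) = (\<lambda>x. \<Sum>i\<in>I. dir_deriv v (f i) x)"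
  by (rule ext, rule dir_deriv_eq[where f' = "\<lambda>v. \<Sum>i\<in>I. dir_deriv v (f i) x" for x])
     (auto intro!: has_derivative_sum Cinf_on_has_derivative)

lemma laplacian_smooth: "Cinf_on UNIV f \<Longrightarrow> Cinf_on UNIV (laplacian f)"
  unfolding laplacian_def[abs_def] by (intro Cinf_on_sum Cinf_on_dir_deriv) auto

lemma laplacian_add:
  "Cinf_on UNIV f \<Longrightarrow> Cinf_on UNIV g \<Longrightarrow>
    laplacian (\<lambda>x. f x + g x) = (\<lambda>x. laplacian f x + laplacian g x)"
  by (simp add: laplacian_def[abs_def] dir_deriv_add Cinf_on_dir_deriv sum.distrib)

lemma laplacian_cmult:
  "Cinf_on UNIV f \<Longrightarrow> laplacian (\<lambda>x. c * f x) = (\<lambda>x. c * laplacian f x)"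
  by (simp add: laplacian_def[abs_def] dir_deriv_cmult Cinf_on_dir_deriv sum_distrib_left)

lemma neg_laplacian_pow_0 [simp]: "neg_laplacian_pow 0 f = f"
  by (simp add: neg_laplacian_pow_def)

lemma neg_laplacian_pow_Suc:
  "neg_laplacian_pow (Suc k) f = neg_laplacian_pow k (\<lambda>x. - laplacian f x)"
  by (simp only: neg_laplacian_pow_def funpow_Suc_right o_apply)

lemma neg_laplacian_pow_Suc':
  "neg_laplacian_pow (Suc k) f = (\<lambda>x. - laplacian (neg_laplacian_pow k f) x)"
  by (simp add: neg_laplacian_pow_def)

lemma neg_laplacian_pow_smooth: "Cinf_on UNIV f \<Longrightarrow> Cinf_on UNIV (neg_laplacian_pow k f)"
  by (induction k) (auto simp: neg_laplacian_pow_Suc' intro: Cinf_on_uminus laplacian_smooth)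

lemma neg_laplacian_pow_add:
  "Cinf_on UNIV f \<Longrightarrow> Cinf_on UNIV g \<Longrightarrow>
    neg_laplacian_pow k (\<lambda>x. f x + g x) = (\<lambda>x. neg_laplacian_pow k f x + neg_laplacian_pow k g x)"
  by (induction k) (simp_all add: neg_laplacian_pow_Suc' laplacian_add neg_laplacian_pow_smooth)

lemma neg_laplacian_pow_cmult:
  "Cinf_on UNIV f \<Longrightarrow> neg_laplacian_pow k (\<lambda>x. c * f x) = (\<lambda>x. c * neg_laplacian_pow k f x)"
  by (induction k) (simp_all add: neg_laplacian_pow_Suc' laplacian_cmult neg_laplacian_pow_smooth)

lemma neg_laplacian_pow_sum:
  assumes "finite I" and "\<And>i. i \<in> I \<Longrightarrow> Cinf_on UNIV (f i)"
  shows "neg_laplacian_pow k (\<lambda>x. \<Sum>i\<in>I. f i x) = (\<lambda>x. \<Sum>i\<in>I. neg_laplacian_pow k (f i) x)"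
  using assms
proof (induction I rule: finite_induct)
  case empty
  have "neg_laplacian_pow k (\<lambda>x. 0) = (\<lambda>x::'b. 0)"
    using neg_laplacian_pow_cmult[of "\<lambda>x. 0" k 0] by simp
  then show ?case by simp
next
  case (insert i I)
  then show ?case by (simp add: neg_laplacian_pow_add Cinf_on_sum)
qed

text \<open>Vanishing at the origin together with all derivatives of order less than \<open>k\<close>. The recursive form
  lets the product rule do all the work and avoids Taylor's theorem in several variables.\<close>

primrec vanishes_to_order :: "nat \<Rightarrow> ('a::euclidean_space \<Rightarrow> real) \<Rightarrow> bool" where
  "vanishes_to_order 0 f \<longleftrightarrow> True"
| "vanishes_to_order (Suc k) f \<longleftrightarrow> f 0 = 0 \<and> (\<forall>v. vanishes_to_order k (dir_deriv v f))"

lemma vanishes_to_order_Suc_D: "vanishes_to_order (Suc k) f \<Longrightarrow> vanishes_to_order k f"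
  by (induction k arbitrary: f) auto

lemma vanishes_to_order_0 [simp]: "vanishes_to_order k (\<lambda>x. 0)"
  by (induction k) auto

lemma vanishes_to_order_add:
  "Cinf_on UNIV f \<Longrightarrow> Cinf_on UNIV g \<Longrightarrow> vanishes_to_order k f \<Longrightarrow> vanishes_to_order k g \<Longrightarrow>
    vanishes_to_order k (\<lambda>x. f x + g x)"
  by (induction k arbitrary: f g) (auto simp: dir_deriv_add Cinf_on_dir_deriv)

lemma vanishes_to_order_sum:
  assumes "finite I" and "\<And>i. i \<in> I \<Longrightarrow> Cinf_on UNIV (f i)"
    and "\<And>i. i \<in> I \<Longrightarrow> vanishes_to_order k (f i)"
  shows "vanishes_to_order k (\<lambda>x. \<Sum>i\<in>I. f i x)"
  using assms by (induction I rule: finite_induct) (auto intro!: vanishes_to_order_add Cinf_on_sum)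

lemma vanishes_to_order_cmult:
  "Cinf_on UNIV f \<Longrightarrow> vanishes_to_order k f \<Longrightarrow> vanishes_to_order k (\<lambda>x. c * f x)"
  by (induction k arbitrary: f) (auto simp: dir_deriv_cmult Cinf_on_dir_deriv)

text \<open>The orders of vanishing add up: each term of the product rule loses one order in one factor only.\<close>

lemma vanishes_to_order_mult:
  assumes "Cinf_on UNIV f" "Cinf_on UNIV g" "vanishes_to_order j f" "vanishes_to_order k g"
  shows "vanishes_to_order (j + k) (\<lambda>x. f x * g x)"
  using assms
proof (induction "j + k" arbitrary: j k f g)
  case (Suc l)
  have zero: "f 0 * g 0 = 0"
    using Suc.hyps(2) Suc.prems(3,4) by (cases j; cases k) auto
  have "vanishes_to_order l (\<lambda>x. f x * dir_deriv v g x)" for v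
  proof (cases k)
    case 0
    obtain j' where "j = Suc j'" using 0 Suc.hyps(2) by (cases j) auto
    with 0 Suc show ?thesis
      using Suc.hyps(1)[of j' 0 f "dir_deriv v g"] vanishes_to_order_Suc_D[of j' f]
      by (simp add: Cinf_on_dir_deriv)
  next
    case (Suc k')
    with Suc.hyps(2) Suc.prems show ?thesis
      using Suc.hyps(1)[of j k' f "dir_deriv v g"] by (simp add: Cinf_on_dir_deriv)
  qed
  moreover have "vanishes_to_order l (\<lambda>x. dir_deriv v f x * g x)" for v
  proof (cases j)
    case 0
    obtain k' where "k = Suc k'" using 0 Suc.hyps(2) by (cases k) auto
    with 0 Suc show ?thesis
      using Suc.hyps(1)[of 0 k' "dir_deriv v f" g] vanishes_to_order_Suc_D[of k' g]
      by (simp add: Cinf_on_dir_deriv)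
  next
    case (Suc j')
    with Suc.hyps(2) Suc.prems show ?thesis
      using Suc.hyps(1)[of j' k "dir_deriv v f" g] by (simp add: Cinf_on_dir_deriv)
  qed
  ultimately have "vanishes_to_order (Suc l) (\<lambda>x. f x * g x)"
    using zero Suc.prems(1,2)
    by (auto simp: dir_deriv_mult intro!: vanishes_to_order_add Cinf_on_mult Cinf_on_dir_deriv)
  then show ?case using Suc.hyps(2) by simp
qed auto

lemma vanishes_to_order_neg_laplacian_pow:
  "Cinf_on UNIV f \<Longrightarrow> vanishes_to_order (k + 2 * j) f \<Longrightarrow> vanishes_to_order k (neg_laplacian_pow j f)"
proof (induction j arbitrary: f)
  case (Suc j)
  have "vanishes_to_order (k + 2 * j) (dir_deriv b (dir_deriv b f))" for b
    using Suc.prems(2) by simp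
  then have "vanishes_to_order (k + 2 * j) (laplacian f)"
    unfolding laplacian_def[abs_def] using Suc.prems(1)
    by (intro vanishes_to_order_sum Cinf_on_dir_deriv) auto
  then have "vanishes_to_order (k + 2 * j) (\<lambda>x. - laplacian f x)"
    using vanishes_to_order_cmult[of "laplacian f" "k + 2 * j" "-1"] Suc.prems(1)
    by (simp add: laplacian_smooth)
  then show ?case
    unfolding neg_laplacian_pow_Suc
    using Suc.prems(1) by (intro Suc.IH Cinf_on_uminus laplacian_smooth) auto
qed simp

text \<open>The remainder of the Taylor expansion of \<open>t powr a\<close> at 1. Its derivative is again such a
  remainder, for \<open>a - 1\<close>, so that its composition with a function can be handled by induction.\<close>

definition powr_taylor_rest :: "real \<Rightarrow> nat \<Rightarrow> real \<Rightarrow> real" where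
  "powr_taylor_rest a k t = t powr a - (\<Sum>i<k. (a gchoose i) * (t - 1) ^ i)"

lemma powr_taylor_rest_has_derivative:
  assumes "t > 0"
  shows "(powr_taylor_rest a (Suc k) has_real_derivative a * powr_taylor_rest (a - 1) k t) (at t)"
proof -
  have "((\<lambda>t. \<Sum>i<Suc k. (a gchoose i) * (t - 1) ^ i) has_real_derivative
      (\<Sum>i<Suc k. (a gchoose i) * (real i * (t - 1) ^ (i - 1)))) (at t)"
    by (auto intro!: derivative_eq_intros sum.cong)
  also have "(\<Sum>i<Suc k. (a gchoose i) * (real i * (t - 1) ^ (i - 1)))
      = (\<Sum>i<k. (real (Suc i) * (a gchoose Suc i)) * (t - 1) ^ i)"
    by (subst sum.lessThan_Suc_shift) (simp add: mult_ac)
  also have "\<dots> = a * (\<Sum>i<k. ((a - 1) gchoose i) * (t - 1) ^ i)"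
    by (simp only: gbinomial_absorption sum_distrib_left mult.assoc)
  finally show ?thesis
    unfolding powr_taylor_rest_def[abs_def] right_diff_distrib
    by (intro DERIV_diff has_real_derivative_powr assms)
qed

lemma powr_taylor_rest_smooth:
  "Cinf_on UNIV u \<Longrightarrow> (\<And>x. u x > 0) \<Longrightarrow> Cinf_on UNIV (\<lambda>x. powr_taylor_rest a k (u x))"
proof -
  assume u: "Cinf_on UNIV u" "\<And>x. u x > 0"
  have "Cinf_on UNIV (\<lambda>x. (u x - 1) ^ i)" for i
    using u by (induction i) (auto intro!: Cinf_on_mult Cinf_on_diff)
  then show ?thesis
    unfolding powr_taylor_rest_def
    using u by (intro Cinf_on_diff Cinf_on_sum Cinf_on_powr Cinf_on_cmult) auto
qed

text \<open>Each step of the induction gains two orders: one for the differentiation and one because the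
  derivative of \<open>u\<close> vanishes at the origin.\<close>

lemma vanishes_to_order_powr_taylor_rest:
  assumes u: "Cinf_on UNIV u" "\<And>x. u x > 0" and v: "vanishes_to_order 2 (\<lambda>x. u x - 1)"
  shows "vanishes_to_order (2 * k) (\<lambda>x. powr_taylor_rest a k (u x))"
proof (induction k arbitrary: a)
  case (Suc k)
  have u0: "u 0 = 1" using v by (simp add: numeral_2_eq_2)
  have du: "vanishes_to_order 1 (dir_deriv w u)" for w
  proof -
    have "dir_deriv w (\<lambda>x. u x - 1) = dir_deriv w u"
      using dir_deriv_add[OF u(1), of "\<lambda>x. -1" w] by simp
    with v show ?thesis by (metis One_nat_def numeral_2_eq_2 vanishes_to_order.simps(2))
  qed
  have "(\<Sum>i<k. (a gchoose Suc i) * (0::real) ^ Suc i) = 0" by simp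
  then have zero: "powr_taylor_rest a (Suc k) (u 0) = 0"
    unfolding powr_taylor_rest_def u0 by (subst sum.lessThan_Suc_shift) simp
  have der: "dir_deriv w (\<lambda>x. powr_taylor_rest a (Suc k) (u x))
      = (\<lambda>x. a * (powr_taylor_rest (a - 1) k (u x) * dir_deriv w u x))" for w
  proof (rule ext, rule dir_deriv_eq[THEN trans])
    show "((\<lambda>x. powr_taylor_rest a (Suc k) (u x)) has_derivative
        (\<lambda>w. a * powr_taylor_rest (a - 1) k (u x) * dir_deriv w u x)) (at x)" for x
      using diff_chain_at[OF Cinf_on_has_derivative[OF u(1), of x]
          powr_taylor_rest_has_derivative[OF u(2), of a k x, unfolded has_field_derivative_def]]
      by (simp add: o_def)
  qed simp
  have "vanishes_to_order (2 * k + 1) (\<lambda>x. powr_taylor_rest (a - 1) k (u x) * dir_deriv w u x)" for w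
    using Suc du u by (intro vanishes_to_order_mult powr_taylor_rest_smooth Cinf_on_dir_deriv) auto
  then have "vanishes_to_order (2 * k + 1) (dir_deriv w (\<lambda>x. powr_taylor_rest a (Suc k) (u x)))" for w
    unfolding der using u
    by (intro vanishes_to_order_cmult Cinf_on_mult powr_taylor_rest_smooth Cinf_on_dir_deriv) auto
  then have "vanishes_to_order (Suc (2 * k + 1)) (\<lambda>x. powr_taylor_rest a (Suc k) (u x))"
    using zero by (subst vanishes_to_order.simps(2)) blast
  then show ?case by simp
qed simp

text \<open>The remainder after the cubic term vanishes to order 8, and six derivatives are taken. This is where it
  is used that \<open>u\<close> has a critical point at the origin.\<close>

lemma neg_laplacian_pow_3_powr:
  assumes u: "Cinf_on UNIV u" "\<And>x. u x > 0" and v: "vanishes_to_order 2 (\<lambda>x. u x - 1)"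
  shows "neg_laplacian_pow 3 (\<lambda>x. u x powr a) 0 =
    (\<Sum>i<4. (a gchoose i) * neg_laplacian_pow 3 (\<lambda>x. (u x - 1) ^ i) 0)"
proof -
  have pw: "Cinf_on UNIV (\<lambda>x. (u x - 1) ^ i)" for i
    using u by (induction i) (auto intro!: Cinf_on_mult Cinf_on_diff)
  let ?r = "\<lambda>x. powr_taylor_rest a 4 (u x)"
  have r: "Cinf_on UNIV ?r" using u by (rule powr_taylor_rest_smooth)
  have "vanishes_to_order (1 + 2 * 3) ?r"
    using vanishes_to_order_powr_taylor_rest[OF u v, where a = a and k = 4]
    by (simp add: numeral_eq_Suc vanishes_to_order_Suc_D del: vanishes_to_order.simps)
  then have r0: "neg_laplacian_pow 3 ?r 0 = 0"
    using vanishes_to_order_neg_laplacian_pow[OF r, of 1 3] by simp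
  have eq: "(\<lambda>x. u x powr a) = (\<lambda>x. ?r x + (\<Sum>i<4. (a gchoose i) * (u x - 1) ^ i))"
    by (simp add: powr_taylor_rest_def)
  show ?thesis
    unfolding eq using r r0 pw
    by (simp add: neg_laplacian_pow_add neg_laplacian_pow_sum neg_laplacian_pow_cmult
        Cinf_on_sum Cinf_on_cmult)
qed

section \<open>The Laplacian on monomials in bubbles\<close>

text \<open>The form \<open>|x - y|\<^sup>2 + 1 - |y|\<^sup>2\<close> shows the positivity; the constant is chosen so that the
  value at the origin is 1 for all \<open>y\<close>.\<close>

definition bubble_quad :: "'a::euclidean_space \<Rightarrow> 'a \<Rightarrow> real" where
  "bubble_quad y x = 1 - 2 * (x \<bullet> y) + x \<bullet> x"

lemma bubble_quad_0 [simp]: "bubble_quad y 0 = 1"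
  by (simp add: bubble_quad_def)

lemma bubble_quad_eq: "bubble_quad y x = (norm (x - y))\<^sup>2 + (1 - (norm y)\<^sup>2)"
  by (simp add: bubble_quad_def power2_norm_eq_inner inner_diff inner_commute algebra_simps)

lemma bubble_quad_pos: "norm y < 1 \<Longrightarrow> bubble_quad y x > 0"
  unfolding bubble_quad_eq by (intro add_nonneg_pos) (simp_all add: abs_square_less_1)

lemma bubble_quad_smooth: "Cinf_on UNIV (bubble_quad y)"
  unfolding bubble_quad_def[abs_def]
  by (intro Cinf_on_add Cinf_on_diff Cinf_on_cmult Cinf_on_inner Cinf_on_const
      Cinf_on_bounded_linear[OF bounded_linear_ident]) auto

lemma dir_deriv_bubble_quad: "dir_deriv v (bubble_quad y) = (\<lambda>x. 2 * ((x - y) \<bullet> v))"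
proof (rule ext, rule dir_deriv_eq[THEN trans])
  show "(bubble_quad y has_derivative (\<lambda>v. 2 * ((x - y) \<bullet> v))) (at x)" for x
    unfolding bubble_quad_def[abs_def]
    by (auto intro!: derivative_eq_intros simp: inner_commute algebra_simps)
qed simp

lemma dir_deriv_2_bubble_quad: "dir_deriv v (dir_deriv v (bubble_quad y)) = (\<lambda>x. 2 * (v \<bullet> v))"
proof (rule ext, rule dir_deriv_eq[THEN trans])
  show "(dir_deriv v (bubble_quad y) has_derivative (\<lambda>w. 2 * (w \<bullet> v))) (at x)" for x
    unfolding dir_deriv_bubble_quad
    by (auto intro!: derivative_eq_intros)
qed simp

text \<open>The inner product of two gradients is an affine combination of the functions themselves. This closes
  the algebra of their monomials under the Laplacian.\<close>

lemma gradient_bubble_quad: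
  "(\<Sum>b\<in>Basis. dir_deriv b (bubble_quad y) x * dir_deriv b (bubble_quad z) x)
    = 2 * bubble_quad y x + 2 * bubble_quad z x - 2 * (2 - 2 * (y \<bullet> z))"
proof -
  have "(\<Sum>b\<in>Basis. dir_deriv b (bubble_quad y) x * dir_deriv b (bubble_quad z) x)
      = (\<Sum>b\<in>Basis. 4 * (((x - y) \<bullet> b) * ((x - z) \<bullet> b)))"
    by (simp add: dir_deriv_bubble_quad mult_ac)
  also have "\<dots> = 4 * ((x - y) \<bullet> (x - z))"
    by (subst (3) euclidean_inner) (simp add: sum_distrib_left)
  finally show ?thesis
    by (simp add: bubble_quad_def inner_diff inner_commute algebra_simps)
qed

definition quad_monomial ::
  "'a::euclidean_space \<Rightarrow> 'a \<Rightarrow> 'a \<Rightarrow> real \<Rightarrow> real \<Rightarrow> real \<Rightarrow> 'a \<Rightarrow> real" where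
  "quad_monomial y1 y2 y3 a b c x
     = bubble_quad y1 x powr a * bubble_quad y2 x powr b * bubble_quad y3 x powr c"

context
  fixes y1 y2 y3 :: "'a::euclidean_space"
  assumes y: "norm y1 < 1" "norm y2 < 1" "norm y3 < 1"
begin

private abbreviation (input) "M \<equiv> quad_monomial y1 y2 y3"
private abbreviation (input) "q1 \<equiv> bubble_quad y1"
private abbreviation (input) "q2 \<equiv> bubble_quad y2"
private abbreviation (input) "q3 \<equiv> bubble_quad y3"

lemma quad_monomial_smooth: "Cinf_on UNIV (M a b c)"
  unfolding quad_monomial_def[abs_def] using y
  by (intro Cinf_on_mult Cinf_on_powr bubble_quad_smooth bubble_quad_pos) auto

lemma quad_monomial_lower:
  "M (a - 1) b c x * q1 x = M a b c x"
  "M a (b - 1) c x * q2 x = M a b c x"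
  "M a b (c - 1) x * q3 x = M a b c x"
  using y[THEN bubble_quad_pos, of x] by (simp_all add: quad_monomial_def powr_diff)

lemma dir_deriv_quad_monomial:
  "dir_deriv v (M a b c) = (\<lambda>x. a * (M (a - 1) b c x * dir_deriv v q1 x)
     + (b * (M a (b - 1) c x * dir_deriv v q2 x) + c * (M a b (c - 1) x * dir_deriv v q3 x)))"
proof -
  have pw: "Cinf_on UNIV (\<lambda>x. bubble_quad z x powr e)" if "norm z < 1" for z :: 'a and e
    using that by (intro Cinf_on_powr bubble_quad_smooth bubble_quad_pos) auto
  have d: "dir_deriv v (\<lambda>x. bubble_quad z x powr e)
      = (\<lambda>x. e * (bubble_quad z x powr (e - 1) * dir_deriv v (bubble_quad z) x))"
    if "norm z < 1" for z :: 'a and e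
    using dir_deriv_powr[OF bubble_quad_smooth _ bubble_quad_pos[OF that]] by blast
  show ?thesis
    unfolding quad_monomial_def[abs_def] using y
    by (simp add: dir_deriv_mult Cinf_on_mult pw d algebra_simps)
qed

text \<open>The numbers \<open>e\<close> and \<open>dij\<close> are \<open>2 - 2 y \<bullet> z\<close> for the respective centres. The second
  summand of the first line collects \<open>4 a (a - 1)\<close> from the squared gradient of one factor and \<open>4 a b\<close>, \<open>4 a c\<close>
  from the mixed products of gradients.\<close>

lemma laplacian_quad_monomial:
  assumes e: "norm y1 ^ 2 = 1 - e / 2" "norm y2 ^ 2 = 1 - e / 2" "norm y3 ^ 2 = 1 - e / 2"
    and d: "y1 \<bullet> y2 = 1 - d12 / 2" "y1 \<bullet> y3 = 1 - d13 / 2" "y2 \<bullet> y3 = 1 - d23 / 2"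
  shows "laplacian (M a b c) x =
      (2 * real DIM('a) + 4 * (a + b + c - 1)) *
        (a * M (a - 1) b c x + b * M a (b - 1) c x + c * M a b (c - 1) x)
      - 4 * (d12 * a * b * M (a - 1) (b - 1) c x + d13 * a * c * M (a - 1) b (c - 1) x
           + d23 * b * c * M a (b - 1) (c - 1) x)
      - 2 * e * (a * (a - 1) * M (a - 1 - 1) b c x + b * (b - 1) * M a (b - 1 - 1) c x
           + c * (c - 1) * M a b (c - 1 - 1) x)"
proof -
  define g where "g z w = (\<Sum>b\<in>Basis. dir_deriv b (bubble_quad z) x * dir_deriv b (bubble_quad w) x)"
    for z w :: 'a
  define h where "h z = (\<Sum>b\<in>Basis. dir_deriv b (dir_deriv b (bubble_quad z)) x)" for z :: 'a
  have h: "h z = 2 * real DIM('a)" for z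
    by (simp add: h_def dir_deriv_2_bubble_quad)
  have sm: "Cinf_on UNIV (\<lambda>x. M a b c x * dir_deriv v (bubble_quad z) x)" for a b c v z
    by (intro Cinf_on_mult quad_monomial_smooth Cinf_on_dir_deriv bubble_quad_smooth) auto
  have dd: "dir_deriv v (dir_deriv v (M a b c)) x =
     a * (M (a - 1) b c x * dir_deriv v (dir_deriv v q1) x) +
     b * (M a (b - 1) c x * dir_deriv v (dir_deriv v q2) x) +
     c * (M a b (c - 1) x * dir_deriv v (dir_deriv v q3) x) +
     a * (a - 1) * M (a - 1 - 1) b c x * (dir_deriv v q1 x * dir_deriv v q1 x) +
     b * (b - 1) * M a (b - 1 - 1) c x * (dir_deriv v q2 x * dir_deriv v q2 x) +
     c * (c - 1) * M a b (c - 1 - 1) x * (dir_deriv v q3 x * dir_deriv v q3 x) +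
     2 * a * b * M (a - 1) (b - 1) c x * (dir_deriv v q1 x * dir_deriv v q2 x) +
     2 * a * c * M (a - 1) b (c - 1) x * (dir_deriv v q1 x * dir_deriv v q3 x) +
     2 * b * c * M a (b - 1) (c - 1) x * (dir_deriv v q2 x * dir_deriv v q3 x)" for v
    by (subst dir_deriv_quad_monomial)
       (simp add: dir_deriv_add dir_deriv_cmult dir_deriv_mult sm Cinf_on_add Cinf_on_cmult
        quad_monomial_smooth Cinf_on_dir_deriv bubble_quad_smooth dir_deriv_quad_monomial
        del: dir_deriv_bubble_quad, simp add: algebra_simps)
  have "laplacian (M a b c) x =
     a * (M (a - 1) b c x * h y1) + b * (M a (b - 1) c x * h y2) + c * (M a b (c - 1) x * h y3) +
     a * (a - 1) * M (a - 1 - 1) b c x * g y1 y1 +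
     b * (b - 1) * M a (b - 1 - 1) c x * g y2 y2 +
     c * (c - 1) * M a b (c - 1 - 1) x * g y3 y3 +
     2 * a * b * M (a - 1) (b - 1) c x * g y1 y2 +
     2 * a * c * M (a - 1) b (c - 1) x * g y1 y3 +
     2 * b * c * M a (b - 1) (c - 1) x * g y2 y3"
    unfolding laplacian_def dd g_def h_def by (simp only: sum.distrib sum_distrib_left)
  moreover have "g y1 y1 = 4 * q1 x - 2 * e" "g y2 y2 = 4 * q2 x - 2 * e" "g y3 y3 = 4 * q3 x - 2 * e"
    "g y1 y2 = 2 * q1 x + 2 * q2 x - 2 * d12" "g y1 y3 = 2 * q1 x + 2 * q3 x - 2 * d13"
    "g y2 y3 = 2 * q2 x + 2 * q3 x - 2 * d23"
    using e d by (simp_all add: g_def gradient_bubble_quad power2_norm_eq_inner)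
  ultimately show ?thesis
    using quad_monomial_lower(1)[of "a - 1" b c x] quad_monomial_lower(2)[of a "b - 1" c x]
      quad_monomial_lower(3)[of a b "c - 1" x]
      quad_monomial_lower(1)[of a "b - 1" c x] quad_monomial_lower(1)[of a b "c - 1" x]
      quad_monomial_lower(2)[of "a - 1" b c x] quad_monomial_lower(2)[of a b "c - 1" x]
      quad_monomial_lower(3)[of "a - 1" b c x] quad_monomial_lower(3)[of a "b - 1" c x]
    unfolding h by algebra
qed

end

text \<open>The coefficients of \<open>laplacian_quad_monomial\<close>, iterated \<open>k\<close> times with a change of sign.\<close>

primrec quad_lap :: "nat \<Rightarrow> real \<Rightarrow> real \<Rightarrow> real \<Rightarrow> real \<Rightarrow> real \<Rightarrow> real \<Rightarrow> real \<Rightarrow> real \<Rightarrow> real" where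
  "quad_lap 0 n e d12 d13 d23 a b c = 1"
| "quad_lap (Suc k) n e d12 d13 d23 a b c =
      - (2 * n + 4 * (a + b + c - 1)) *
        (a * quad_lap k n e d12 d13 d23 (a - 1) b c + b * quad_lap k n e d12 d13 d23 a (b - 1) c
         + c * quad_lap k n e d12 d13 d23 a b (c - 1))
      + 4 * (d12 * a * b * quad_lap k n e d12 d13 d23 (a - 1) (b - 1) c
           + d13 * a * c * quad_lap k n e d12 d13 d23 (a - 1) b (c - 1)
           + d23 * b * c * quad_lap k n e d12 d13 d23 a (b - 1) (c - 1))
      + 2 * e * (a * (a - 1) * quad_lap k n e d12 d13 d23 (a - 1 - 1) b c
           + b * (b - 1) * quad_lap k n e d12 d13 d23 a (b - 1 - 1) c
           + c * (c - 1) * quad_lap k n e d12 d13 d23 a b (c - 1 - 1))"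

text \<open>All monomials are 1 at the origin, so that only the coefficients remain.\<close>

lemma neg_laplacian_pow_quad_monomial_0:
  fixes y1 y2 y3 :: "'a::euclidean_space"
  assumes y: "norm y1 < 1" "norm y2 < 1" "norm y3 < 1"
    and e: "norm y1 ^ 2 = 1 - e / 2" "norm y2 ^ 2 = 1 - e / 2" "norm y3 ^ 2 = 1 - e / 2"
    and d: "y1 \<bullet> y2 = 1 - d12 / 2" "y1 \<bullet> y3 = 1 - d13 / 2" "y2 \<bullet> y3 = 1 - d23 / 2"
  shows "neg_laplacian_pow k (quad_monomial y1 y2 y3 a b c) 0
      = quad_lap k (real DIM('a)) e d12 d13 d23 a b c"
proof (induction k arbitrary: a b c)
  case 0
  then show ?case by (simp add: quad_monomial_def)
next
  case (Suc k)
  let ?M = "quad_monomial y1 y2 y3"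
  note sm = quad_monomial_smooth[OF y]
  let ?s = "- (2 * real DIM('a) + 4 * (a + b + c - 1))"
  have eq: "(\<lambda>x. - laplacian (?M a b c) x) = (\<lambda>x.
      (?s * a) * ?M (a - 1) b c x + ((?s * b) * ?M a (b - 1) c x + ((?s * c) * ?M a b (c - 1) x
      + ((4 * d12 * a * b) * ?M (a - 1) (b - 1) c x + ((4 * d13 * a * c) * ?M (a - 1) b (c - 1) x
      + ((4 * d23 * b * c) * ?M a (b - 1) (c - 1) x
      + ((2 * e * a * (a - 1)) * ?M (a - 1 - 1) b c x + ((2 * e * b * (b - 1)) * ?M a (b - 1 - 1) c x
      + (2 * e * c * (c - 1)) * ?M a b (c - 1 - 1) x))))))))"
    unfolding laplacian_quad_monomial[OF y e d] by (rule ext) algebra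
  show ?case
    unfolding neg_laplacian_pow_Suc eq
    by (simp only: neg_laplacian_pow_add neg_laplacian_pow_cmult Cinf_on_add Cinf_on_cmult open_UNIV
        sm Suc.IH quad_lap.simps) algebra
qed

section \<open>The value for a regular simplex\<close>

lemma continuous_quad_lap:
  assumes "isCont e s" "isCont d12 s" "isCont d13 s" "isCont d23 s"
  shows "isCont (\<lambda>s. quad_lap k n (e s) (d12 s) (d13 s) (d23 s) a b c) s"
  by (induction k arbitrary: a b c) (auto intro!: continuous_intros assms)

lemma sum_diagonal:
  fixes f :: "bool \<Rightarrow> real"
  assumes "finite I" and "i \<in> I"
  shows "(\<Sum>j\<in>I. f (i = j)) = f True + (real (card I) - 1) * f False"
proof -
  have "(\<Sum>j\<in>I. f (i = j)) = f True + (\<Sum>j\<in>I - {i}. f (i = j))"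
    using assms by (simp add: sum.remove)
  also have "(\<Sum>j\<in>I - {i}. f (i = j)) = (\<Sum>j\<in>I - {i}. f False)"
    by (intro sum.cong) auto
  moreover have "card I > 0" using assms by (auto simp: card_gt_0_iff)
  ultimately show ?thesis using assms by (simp add: of_nat_diff Suc_le_eq)
qed

text \<open>For the third power of a sum over the vertices of a simplex: a product of three terms depends, up to
  symmetries of the simplex, only on which of the three vertices coincide.\<close>

lemma sum_equality_pattern:
  fixes f :: "bool \<Rightarrow> bool \<Rightarrow> bool \<Rightarrow> real"
  assumes "finite I" and i: "i \<in> I"
  shows "(\<Sum>j\<in>I. \<Sum>k\<in>I. f (i = j) (i = k) (j = k)) =
    f True True True + (real (card I) - 1) *
      (f True False False + f False True False + f False False True
       + (real (card I) - 2) * f False False False)"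
proof -
  have inner: "(\<Sum>k\<in>I. f False (i = k) (j = k))
      = f False True False + f False False True + (real (card I) - 2) * f False False False"
    if "j \<in> I" "j \<noteq> i" for j
  proof -
    have "(\<Sum>k\<in>I. f False (i = k) (j = k)) = (\<Sum>k\<in>I - {i}. f False False (j = k)) + f False True False"
    proof -
      have "f False (i = k) (j = k) = f False False (j = k)" if "k \<in> I - {i}" for k
      proof -
        have "(i = k) = False" using that by auto
        then show ?thesis by simp
      qed
      then have "(\<Sum>k\<in>I - {i}. f False (i = k) (j = k)) = (\<Sum>k\<in>I - {i}. f False False (j = k))"
        by (intro sum.cong) auto
      then show ?thesis using assms that by (subst sum.remove[of I i]) auto
    qed
    also have "(\<Sum>k\<in>I - {i}. f False False (j = k))
        = f False False True + (real (card (I - {i})) - 1) * f False False False"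
      using assms that by (intro sum_diagonal) auto
    moreover have "card I > 0" using assms by (auto simp: card_gt_0_iff)
    ultimately show ?thesis using assms by (simp add: of_nat_diff Suc_le_eq)
  qed
  have "(\<Sum>j\<in>I. \<Sum>k\<in>I. f (i = j) (i = k) (j = k))
      = (\<Sum>k\<in>I. f True (i = k) (i = k)) + (\<Sum>j\<in>I - {i}. \<Sum>k\<in>I. f (i = j) (i = k) (j = k))"
    using assms by (subst sum.remove[of I i]) auto
  also have "(\<Sum>j\<in>I - {i}. \<Sum>k\<in>I. f (i = j) (i = k) (j = k)) = (\<Sum>j\<in>I - {i}.
      f False True False + f False False True + (real (card I) - 2) * f False False False)"
    using inner by (intro sum.cong) auto
  also have "(\<Sum>k\<in>I. f True (i = k) (i = k)) = f True True True + (real (card I) - 1) * f True False False"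
    using sum_diagonal[OF assms, of "\<lambda>b. f True b b"] .
  moreover have "card I > 0" using assms by (auto simp: card_gt_0_iff)
  ultimately show ?thesis using assms by (simp add: of_nat_diff Suc_le_eq algebra_simps)
qed

text \<open>The value at the origin of \<open>(-\<Delta>)\<^sup>3\<close> of the \<open>p\<close>-th power, for \<open>p = 1, 2, 3\<close>, of the average \<open>u\<close> of nine
  bubbles with exponent \<open>-l\<close>. The number \<open>2 - 2 y \<bullet> z\<close> is \<open>e\<close> for equal centres and \<open>d\<close> for
  different ones. The factors 8 and 7 count the vertices that differ from one and from two given ones.\<close>

definition simplex_moment :: "nat \<Rightarrow> real \<Rightarrow> real \<Rightarrow> real \<Rightarrow> real \<Rightarrow> real" where
  "simplex_moment p n l e d =
    (if p = 1 then quad_lap 3 n e e e e (- l) 0 0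
     else if p = 2 then (quad_lap 3 n e e e e (- l) (- l) 0 + 8 * quad_lap 3 n e d d e (- l) (- l) 0) / 9
     else (quad_lap 3 n e e e e (- l) (- l) (- l)
       + 8 * (quad_lap 3 n e e d d (- l) (- l) (- l) + quad_lap 3 n e d e d (- l) (- l) (- l)
         + quad_lap 3 n e d d e (- l) (- l) (- l) + 7 * quad_lap 3 n e d d d (- l) (- l) (- l))) / 81)"

text \<open>The value at the origin of \<open>(-\<Delta>)\<^sup>3(u\<^sup>a)\<close>: the powers of \<open>u - 1\<close> in \<open>neg_laplacian_pow_3_powr\<close>,
  expanded into powers of \<open>u\<close>.\<close>

definition simplex_value :: "real \<Rightarrow> real \<Rightarrow> real \<Rightarrow> real \<Rightarrow> real \<Rightarrow> real" where
  "simplex_value n l a e d =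
     a * simplex_moment 1 n l e d
     + (a gchoose 2) * (simplex_moment 2 n l e d - 2 * simplex_moment 1 n l e d)
     + (a gchoose 3) * (simplex_moment 3 n l e d - 3 * simplex_moment 2 n l e d
         + 3 * simplex_moment 1 n l e d)"

text \<open>The values \<open>e = 0\<close> and \<open>d = 9/4\<close> belong to nine vertices on the unit sphere, whose inner products
  are \<open>-1/8\<close>.\<close>

lemma simplex_moment_1:
  "simplex_moment 1 n l 0 d = 8 * l * (n - 2 * l - 2) * (n - 2 * l - 4) * (n - 2 * l - 6) * (l + 1) * (l + 2)"
  by (simp add: simplex_moment_def numeral_eq_Suc) algebra

lemma simplex_moment_2:
  "simplex_moment 2 n l 0 (9/4) = (-760) * l ^ 6 + 864 * l ^ 5 * n + (-2832) * l ^ 5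
      + (-384) * l ^ 4 * n ^ 2 + 2688 * l ^ 4 * n + (-4504) * l ^ 4 + 64 * l ^ 3 * n ^ 3
      + (-960) * l ^ 3 * n ^ 2 + 3680 * l ^ 3 * n + (-5088) * l ^ 3 + 96 * l ^ 2 * n ^ 3
      + (-960) * l ^ 2 * n ^ 2 + 3264 * l ^ 2 * n + (-4192) * l ^ 2 + 32 * l * n ^ 3
      + (-384) * l * n ^ 2 + 1408 * l * n + (-1536) * l"
  by (simp add: simplex_moment_def numeral_eq_Suc) algebra

lemma simplex_moment_3:
  "simplex_moment 3 n l 0 (9/4) = (-2808) * l ^ 6 + 3024 * l ^ 5 * n + (-6048) * l ^ 5
      + (-1296) * l ^ 4 * n ^ 2 + 5760 * l ^ 4 * n + (-6264) * l ^ 4 + 216 * l ^ 3 * n ^ 3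
      + (-2160) * l ^ 3 * n ^ 2 + 5328 * l ^ 3 * n + (-5616) * l ^ 3 + 216 * l ^ 2 * n ^ 3
      + (-1728) * l ^ 2 * n ^ 2 + 4320 * l ^ 2 * n + (-4896) * l ^ 2 + 48 * l * n ^ 3
      + (-576) * l * n ^ 2 + 2112 * l * n + (-2304) * l"
  by (simp add: simplex_moment_def numeral_eq_Suc) algebra

text \<open>The combinations \<open>M\<^sub>2 - 2 M\<^sub>1\<close> and \<open>M\<^sub>3 - 3 M\<^sub>2 + 3 M\<^sub>1\<close> of the moments are divisible by \<open>l\<^sup>2\<close> and \<open>l\<^sup>3\<close>.
  This cancels the denominators of the binomial coefficients of \<open>a = (n - 6)/(2 l)\<close>.\<close>

lemma simplex_value_regular:
  fixes n \<mu> :: real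
  assumes n: "n > 2 * \<mu>"
  shows "simplex_value n (n / 2 - \<mu>) ((n - 6) / (n - 2 * \<mu>)) 0 (9/4) =
    - (n - 6) * (\<mu> - 3) * (6 * \<mu>^4 - 26 * \<mu>^3 * n - 168 * \<mu>^3 + 16 * \<mu>^2 * n^2 + 162 * \<mu>^2 * n + 114 * \<mu>^2
      - 15/2 * \<mu> * n^3 - 72 * \<mu> * n^2 - 20 * \<mu> * n + 444 * \<mu> + 5/8 * n^4 + 33/2 * n^3 + 79/2 * n^2
      - 180 * n - 396)"
proof -
  define l where "l = n / 2 - \<mu>"
  define a where "a = (n - 6) / (n - 2 * \<mu>)"
  have l: "l \<noteq> 0" "\<mu> = n / 2 - l" using n by (simp_all add: l_def)
  have a: "2 * l * a = n - 6" using n by (simp add: a_def l_def field_simps)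
  have g2: "2 * (a gchoose 2) = a * (a - 1)"
    by (simp add: numeral_2_eq_2 gbinomial_Suc_rec field_simps)
  have g3: "6 * (a gchoose 3) = a * (a - 1) * (a - 2)"
    by (simp add: numeral_3_eq_3 gbinomial_Suc_rec field_simps)
  define M where "M p = simplex_moment p n l 0 (9/4)" for p
  define B1 C2 C3 where "B1 = 8 * (n - 2 * l - 2) * (n - 2 * l - 4) * (n - 2 * l - 6) * (l + 1) * (l + 2)"
    and "C2 = (-632) * l ^ 4 + 672 * l ^ 3 * n + (-1680) * l ^ 3 + (-288) * l ^ 2 * n ^ 2
        + 1344 * l ^ 2 * n + (-536) * l ^ 2 + 48 * l * n ^ 3 + (-480) * l * n ^ 2 + 288 * l * n
        + 1440 * l + 48 * n ^ 3 + (-192) * n ^ 2 + (-384) * n + 928"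
    and "C3 = (-720) * l ^ 3 + 720 * l ^ 2 * n + 720 * l ^ 2 + (-288) * l * n ^ 2
        + (-288) * l * n + 1296 * l + 48 * n ^ 3 + (-624) * n + (-144)"
  have M1: "M 1 = l * B1" unfolding M_def simplex_moment_1 B1_def by algebra
  have M2: "M 2 - 2 * M 1 = l\<^sup>2 * C2"
    unfolding M_def simplex_moment_1 simplex_moment_2 C2_def by algebra
  have M3: "M 3 - 3 * M 2 + 3 * M 1 = l ^ 3 * C3"
    unfolding M_def simplex_moment_1 simplex_moment_2 simplex_moment_3 C3_def by algebra
  have "simplex_value n l a 0 (9/4)
      = a * (l * B1) + (a gchoose 2) * (l\<^sup>2 * C2) + (a gchoose 3) * (l ^ 3 * C3)"
    unfolding simplex_value_def M_def[symmetric] M1[symmetric] M2[symmetric] M3[symmetric] ..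
  also have "\<dots> = (n - 6) / 2 * (B1 + (n - 6 - 2 * l) / 4 * C2 + (n - 6 - 2 * l) * (n - 6 - 4 * l) / 24 * C3)"
  proof -
    have "48 * (a * (l * B1) + (a gchoose 2) * (l\<^sup>2 * C2) + (a gchoose 3) * (l ^ 3 * C3))
        = (n - 6) * (24 * B1 + 6 * (n - 6 - 2 * l) * C2 + (n - 6 - 2 * l) * (n - 6 - 4 * l) * C3)"
      using a g2 g3 by algebra
    then show ?thesis by (simp add: field_simps)
  qed
  also have "\<dots> = - (n - 6) * (\<mu> - 3) * (6 * \<mu>^4 - 26 * \<mu>^3 * n - 168 * \<mu>^3 + 16 * \<mu>^2 * n^2
      + 162 * \<mu>^2 * n + 114 * \<mu>^2 - 15/2 * \<mu> * n^3 - 72 * \<mu> * n^2 - 20 * \<mu> * n + 444 * \<mu> + 5/8 * n^4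
      + 33/2 * n^3 + 79/2 * n^2 - 180 * n - 396)"
  proof -
    have n: "n = 2 * l + 2 * \<mu>" using l(2) by simp
    show ?thesis unfolding B1_def C2_def C3_def n by (simp add: field_simps) algebra
  qed
  finally show ?thesis unfolding l_def a_def .
qed

text \<open>In the variables \<open>\<mu> - 4\<close> and \<open>n - (10 \<mu> - 11)\<close> all coefficients of the quartic polynomial
  are positive.\<close>

lemma simplex_value_negative:
  fixes n \<mu> :: real
  assumes "\<mu> \<ge> 4" and "n \<ge> 10 * \<mu> - 11"
  shows "simplex_value n (n / 2 - \<mu>) ((n - 6) / (n - 2 * \<mu>)) 0 (9/4) < 0"
proof -
  define p h where "p = \<mu> - 4" and "h = n - (10 * \<mu> - 11)"
  have p: "\<mu> = 4 + p" "n = 29 + 10 * p + h" "p \<ge> 0" "h \<ge> 0"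
    using assms by (auto simp: p_def h_def)
  have "(6 * \<mu>^4 - 26 * \<mu>^3 * n - 168 * \<mu>^3 + 16 * \<mu>^2 * n^2 + 162 * \<mu>^2 * n + 114 * \<mu>^2
      - 15/2 * \<mu> * n^3 - 72 * \<mu> * n^2 - 20 * \<mu> * n + 444 * \<mu> + 5/8 * n^4 + 33/2 * n^3 + 79/2 * n^2
      - 180 * n - 396) = 96*p^4 + 544*p^3*h + 6304*p^3 + 166*p^2*h^2 + 6548*p^2*h + 49990*p^2
      + 35/2*p*h^3 + 2347/2*p*h^2 + 48177/2*p*h + 279937/2*p + 5/8*h^4 + 59*h^3 + 7947/4*h^2
      + 28015*h + 1059733/8"
    unfolding p by algebra
  also have "\<dots> > 0" using p by (intro add_nonneg_pos add_nonneg_nonneg mult_nonneg_nonneg) auto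
  finally show ?thesis
    using assms by (subst simplex_value_regular) (auto simp: mult_less_0_iff zero_less_mult_iff)
qed

section \<open>Averages of bubbles over a simplex\<close>

definition bubble_sum :: "'a set \<Rightarrow> ('a \<Rightarrow> 'a) \<Rightarrow> real \<Rightarrow> 'a::euclidean_space \<Rightarrow> real" where
  "bubble_sum I y l x = (\<Sum>i\<in>I. bubble_quad (y i) x powr (- l)) / real (card I)"

lemma bubble_sum_smooth:
  assumes "\<And>i. i \<in> I \<Longrightarrow> norm (y i) < 1"
  shows "Cinf_on UNIV (bubble_sum I y l)"
  unfolding bubble_sum_def[abs_def] divide_inverse
  using assms bubble_quad_smooth bubble_quad_pos
  by (intro Cinf_on_mult Cinf_on_sum Cinf_on_powr) auto

lemma bubble_sum_pos:
  assumes "finite I" "I \<noteq> {}" and "\<And>i. i \<in> I \<Longrightarrow> norm (y i) < 1"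
  shows "bubble_sum I y l x > 0"
proof -
  have "bubble_quad (y i) x \<noteq> 0" if "i \<in> I" for i
    using bubble_quad_pos[OF assms(3)[OF that], of x] by simp
  then show ?thesis
    unfolding bubble_sum_def using assms
    by (intro divide_pos_pos sum_pos) (auto simp: card_gt_0_iff)
qed

text \<open>The gradient of the average at the origin is a multiple of the sum of the centres.\<close>

lemma bubble_sum_vanishes:
  assumes "finite I" "I \<noteq> {}" and y: "\<And>i. i \<in> I \<Longrightarrow> norm (y i) < 1" and "(\<Sum>i\<in>I. y i) = 0"
  shows "vanishes_to_order 2 (\<lambda>x. bubble_sum I y l x - 1)"
proof -
  have sm: "Cinf_on UNIV (\<lambda>x. bubble_quad (y i) x powr (- l))" if "i \<in> I" for i
    using that y by (intro Cinf_on_powr bubble_quad_smooth bubble_quad_pos) auto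
  have "dir_deriv v (\<lambda>x. bubble_quad (y i) x powr (- l)) 0 = 2 * l * (y i \<bullet> v)" if "i \<in> I" for v i
    using dir_deriv_powr[OF bubble_quad_smooth UNIV_I, of "y i" 0 v "- l"]
    by (simp add: dir_deriv_bubble_quad)
  then have "dir_deriv v (\<lambda>x. \<Sum>i\<in>I. bubble_quad (y i) x powr (- l)) 0 = 2 * l * ((\<Sum>i\<in>I. y i) \<bullet> v)" for v
    using sm by (simp add: dir_deriv_sum sum_distrib_left inner_sum_left)
  then have "dir_deriv v (\<lambda>x. inverse (real (card I)) * (\<Sum>i\<in>I. bubble_quad (y i) x powr (- l)) + (-1)) 0 = 0" for v
    using sm assms(4)
    by (simp only: dir_deriv_add dir_deriv_cmult Cinf_on_cmult Cinf_on_sum Cinf_on_const open_UNIV) simp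
  then have "dir_deriv v (\<lambda>x. bubble_sum I y l x - 1) 0 = 0" for v
    by (simp add: bubble_sum_def divide_inverse mult.commute)
  moreover have "bubble_sum I y l 0 = 1"
    using assms(1,2) by (simp add: bubble_sum_def)
  ultimately show ?thesis by (simp add: numeral_2_eq_2)
qed

lemma neg_laplacian_pow_const: "k > 0 \<Longrightarrow> neg_laplacian_pow k (\<lambda>x::'a::euclidean_space. c) = (\<lambda>x. 0)"
proof (induction k)
  case (Suc k)
  have "laplacian (\<lambda>x::'a. c) = (\<lambda>x. 0)" for c by (simp add: laplacian_def[abs_def])
  with Suc show ?case by (cases k) (simp_all add: neg_laplacian_pow_Suc')
qed simp

text \<open>The hypothesis on the inner products says that the centres are the vertices of a regular simplex.\<close>

lemma neg_laplacian_pow_3_bubble_sum_powr: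
  fixes y :: "'a::euclidean_space \<Rightarrow> 'a"
  assumes I: "card I = 9" and y0: "(\<Sum>i\<in>I. y i) = 0" and e: "e > 0"
    and inner: "\<And>i j. i \<in> I \<Longrightarrow> j \<in> I \<Longrightarrow> y i \<bullet> y j = (if i = j then 1 - e / 2 else 1 - d / 2)"
  shows "neg_laplacian_pow 3 (\<lambda>x. bubble_sum I y l x powr a) 0 = simplex_value (real DIM('a)) l a e d"
proof -
  let ?n = "real DIM('a)"
  have fin: "finite I" "I \<noteq> {}" using I by (auto intro: card_ge_0_finite)
  have nrm: "(norm (y i))\<^sup>2 = 1 - e / 2" if "i \<in> I" for i
    using inner[OF that that] by (simp add: power2_norm_eq_inner)
  have y: "norm (y i) < 1" if "i \<in> I" for i
  proof -
    have "(norm (y i))\<^sup>2 < 1" using nrm[OF that] e by simp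
    then show ?thesis by (simp add: abs_square_less_1)
  qed
  define b where "b i x = bubble_quad (y i) x powr (- l)" for i x
  define B where "B = (\<lambda>x. \<Sum>i\<in>I. b i x)"
  have b: "Cinf_on UNIV (b i)" if "i \<in> I" for i
    unfolding b_def[abs_def] using that y by (intro Cinf_on_powr bubble_quad_smooth bubble_quad_pos) auto
  have B: "Cinf_on UNIV B" unfolding B_def using b by (intro Cinf_on_sum) auto
  define D where "D p = (if p then e else d)" for p
  have inner': "y i \<bullet> y j = 1 - D (i = j) / 2" if "i \<in> I" "j \<in> I" for i j
    using inner that by (simp add: D_def)
  have nz: "bubble_quad (y i) x > 0" if "i \<in> I" for i x
    using that y bubble_quad_pos by blast
  have mono: "neg_laplacian_pow 3 (quad_monomial (y i) (y j) (y k) p q r) 0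
      = quad_lap 3 ?n e (D (i = j)) (D (i = k)) (D (j = k)) p q r"
    if "i \<in> I" "j \<in> I" "k \<in> I" for i j k p q r
    using that by (intro neg_laplacian_pow_quad_monomial_0 y nrm inner')
  \<comment> \<open>A monomial in fewer than three bubbles repeats a centre and gives it the exponent 0.\<close>
  have N1: "neg_laplacian_pow 3 B 0 = 9 * simplex_moment 1 ?n l e d"
  proof -
    have "b i = quad_monomial (y i) (y i) (y i) (- l) 0 0" if "i \<in> I" for i
      using nz[OF that] by (auto simp: b_def[abs_def] quad_monomial_def[abs_def] less_imp_neq[symmetric])
    then have "neg_laplacian_pow 3 (b i) 0 = simplex_moment 1 ?n l e d" if "i \<in> I" for i
      using mono[OF that that that] that by (simp add: simplex_moment_def D_def)
    then show ?thesis
      unfolding B_def using fin b I by (simp add: neg_laplacian_pow_sum)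
  qed
  have N2: "neg_laplacian_pow 3 (\<lambda>x. B x * B x) 0 = 81 * simplex_moment 2 ?n l e d"
  proof -
    have "(\<lambda>x. b i x * b j x) = quad_monomial (y i) (y j) (y j) (- l) (- l) 0" if "i \<in> I" "j \<in> I" for i j
      using nz that by (auto simp: b_def[abs_def] quad_monomial_def[abs_def] less_imp_neq[symmetric])
    then have "neg_laplacian_pow 3 (\<lambda>x. b i x * b j x) 0
        = quad_lap 3 ?n e (D (i = j)) (D (i = j)) e (- l) (- l) 0" if "i \<in> I" "j \<in> I" for i j
      using mono[of i j j] that by (simp add: D_def)
    then have "neg_laplacian_pow 3 (\<lambda>x. \<Sum>i\<in>I. \<Sum>j\<in>I. b i x * b j x) 0
        = (\<Sum>i\<in>I. \<Sum>j\<in>I. quad_lap 3 ?n e (D (i = j)) (D (i = j)) e (- l) (- l) 0)"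
      using fin b by (simp add: neg_laplacian_pow_sum Cinf_on_sum Cinf_on_mult)
    also have "\<dots> = (\<Sum>i\<in>I. 9 * simplex_moment 2 ?n l e d)"
      using sum_diagonal[OF fin(1), of _ "\<lambda>p. quad_lap 3 ?n e (D p) (D p) e (- l) (- l) 0"] I
      by (intro sum.cong refl) (simp add: simplex_moment_def D_def)
    finally show ?thesis
      unfolding B_def sum_product using I by simp
  qed
  have N3: "neg_laplacian_pow 3 (\<lambda>x. B x * B x * B x) 0 = 729 * simplex_moment 3 ?n l e d"
  proof -
    have "(\<lambda>x. b i x * b j x * b k x) = quad_monomial (y i) (y j) (y k) (- l) (- l) (- l)" for i j k
      by (auto simp: b_def[abs_def] quad_monomial_def[abs_def])
    then have "neg_laplacian_pow 3 (\<lambda>x. b i x * b j x * b k x) 0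
        = quad_lap 3 ?n e (D (i = j)) (D (i = k)) (D (j = k)) (- l) (- l) (- l)"
      if "i \<in> I" "j \<in> I" "k \<in> I" for i j k
      using mono[of i j k] that by simp
    then have "neg_laplacian_pow 3 (\<lambda>x. \<Sum>i\<in>I. \<Sum>j\<in>I. \<Sum>k\<in>I. b i x * b j x * b k x) 0
        = (\<Sum>i\<in>I. \<Sum>j\<in>I. \<Sum>k\<in>I. quad_lap 3 ?n e (D (i = j)) (D (i = k)) (D (j = k)) (- l) (- l) (- l))"
      using fin b by (simp add: neg_laplacian_pow_sum Cinf_on_sum Cinf_on_mult)
    also have "\<dots> = (\<Sum>i\<in>I. 81 * simplex_moment 3 ?n l e d)"
      using sum_equality_pattern[OF fin(1),
          of _ "\<lambda>p q r. quad_lap 3 ?n e (D p) (D q) (D r) (- l) (- l) (- l)"] I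
      by (intro sum.cong refl) (simp add: simplex_moment_def D_def)
    also have "(\<lambda>x. \<Sum>i\<in>I. \<Sum>j\<in>I. \<Sum>k\<in>I. b i x * b j x * b k x) = (\<lambda>x. B x * B x * B x)"
      unfolding B_def by (simp add: sum_product sum_distrib_right sum_distrib_left mult_ac)
    finally show ?thesis using I by simp
  qed
  have u: "bubble_sum I y l = (\<lambda>x. B x / 9)"
    using I by (simp add: bubble_sum_def[abs_def] B_def b_def)
  note lin = neg_laplacian_pow_add neg_laplacian_pow_cmult neg_laplacian_pow_const
    Cinf_on_add Cinf_on_cmult Cinf_on_mult B
  have P1: "neg_laplacian_pow 3 (\<lambda>x. B x / 9 - 1) 0 = simplex_moment 1 ?n l e d"
  proof -
    have "(\<lambda>x. B x / 9 - 1) = (\<lambda>x. 1/9 * B x + (-1))" by auto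
    then show ?thesis using N1 by (simp only: lin open_UNIV Cinf_on_const)
  qed
  have P2: "neg_laplacian_pow 3 (\<lambda>x. (B x / 9 - 1)\<^sup>2) 0
      = simplex_moment 2 ?n l e d - 2 * simplex_moment 1 ?n l e d"
  proof -
    have "(\<lambda>x. (B x / 9 - 1)\<^sup>2) = (\<lambda>x. 1/81 * (B x * B x) + ((-2/9) * B x + 1))"
      by (auto simp: power2_eq_square algebra_simps)
    then show ?thesis using N1 N2 by (simp only: lin open_UNIV Cinf_on_const)
  qed
  have P3: "neg_laplacian_pow 3 (\<lambda>x. (B x / 9 - 1) ^ 3) 0
      = simplex_moment 3 ?n l e d - 3 * simplex_moment 2 ?n l e d + 3 * simplex_moment 1 ?n l e d"
  proof -
    have "(\<lambda>x. (B x / 9 - 1) ^ 3)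
        = (\<lambda>x. 1/729 * (B x * B x * B x) + ((-3/81) * (B x * B x) + (1/3 * B x + (-1))))"
      by (rule ext) (simp add: power3_eq_cube field_simps)
    then show ?thesis using N1 N2 N3 by (simp only: lin open_UNIV Cinf_on_const)
  qed
  have P0: "neg_laplacian_pow 3 (\<lambda>x::'a. 1) 0 = 0" by (simp add: neg_laplacian_pow_const)
  have "neg_laplacian_pow 3 (\<lambda>x. bubble_sum I y l x powr a) 0
      = (\<Sum>i<4. (a gchoose i) * neg_laplacian_pow 3 (\<lambda>x. (bubble_sum I y l x - 1) ^ i) 0)"
    using fin y y0
    by (intro neg_laplacian_pow_3_powr bubble_sum_smooth bubble_sum_pos bubble_sum_vanishes)
  also have "{..<4::nat} = {0, 1, 2, 3}" by auto
  finally show ?thesis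
    using P0 P1 P2 P3 by (simp add: u simplex_value_def)
qed

lemma continuous_simplex_moment:
  assumes "isCont e s" "isCont d s"
  shows "isCont (\<lambda>s. simplex_moment p n l (e s) (d s)) s"
proof -
  note Q = continuous_quad_lap[OF assms(1,1,1,1)] continuous_quad_lap[OF assms(1,2,2,1)]
    continuous_quad_lap[OF assms(1,1,2,2)] continuous_quad_lap[OF assms(1,2,1,2)]
    continuous_quad_lap[OF assms(1,2,2,2)]
  consider "p = 1" | "p = 2" | "p \<noteq> 1" "p \<noteq> 2" by blast
  then show ?thesis
    by cases (simp_all add: simplex_moment_def Q isCont_add isCont_mult isCont_divide
        del: quad_lap.simps)
qed

text \<open>Centres on the unit sphere are not allowed, since their bubbles are singular. By continuity the sign persists
  for a slightly smaller simplex. It is spanned by nine basis vectors, shifted to have their barycentre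
  at the origin and scaled by \<open>sqrt \<kappa>\<close>; the vertices lie on the unit sphere for \<open>\<kappa> = 9/8\<close>.\<close>

lemma exists_simplex:
  fixes n \<mu> :: real
  assumes n: "n = real DIM('a::euclidean_space)" and \<mu>: "\<mu> \<ge> 4" "n \<ge> 10 * \<mu> - 11"
  obtains I and y :: "'a::euclidean_space \<Rightarrow> 'a" and r where "finite I" "I \<noteq> {}" "r < 1"
    "\<And>i. i \<in> I \<Longrightarrow> norm (y i) = r"
    "neg_laplacian_pow 3 (\<lambda>x. bubble_sum I y (n / 2 - \<mu>) x powr ((n - 6) / (n - 2 * \<mu>))) 0 < 0"
proof -
  have "DIM('a) \<ge> 9" using assms by linarith
  then obtain I :: "'a set" where I: "I \<subseteq> Basis" "card I = 9" "finite I"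
    using obtain_subset_with_card_n by metis
  let ?E = "simplex_value n (n / 2 - \<mu>) ((n - 6) / (n - 2 * \<mu>))"
  have "isCont (\<lambda>\<kappa>. 2 - 16 / 9 * \<kappa>) (9/8::real)" "isCont (\<lambda>\<kappa>. 2 + 2 / 9 * \<kappa>) (9/8::real)"
    by (intro continuous_intros)+
  note M = continuous_simplex_moment[OF this]
  have "isCont (\<lambda>\<kappa>. ?E (2 - 16 / 9 * \<kappa>) (2 + 2 / 9 * \<kappa>)) (9/8)"
    unfolding simplex_value_def
    by (intro isCont_add isCont_diff isCont_mult continuous_const M)
  then have "((\<lambda>\<kappa>. ?E (2 - 16 / 9 * \<kappa>) (2 + 2 / 9 * \<kappa>)) \<longlongrightarrow> ?E 0 (9/4)) (at (9/8))"
    by (simp add: isCont_def)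
  then have "eventually (\<lambda>\<kappa>. ?E (2 - 16 / 9 * \<kappa>) (2 + 2 / 9 * \<kappa>) < 0) (at (9/8))"
    using order_tendstoD(2) simplex_value_negative[OF \<mu>] by blast
  then obtain \<delta> where \<delta>: "\<delta> > 0"
    "\<And>\<kappa>. \<kappa> \<noteq> 9/8 \<Longrightarrow> dist \<kappa> (9/8) < \<delta> \<Longrightarrow> ?E (2 - 16 / 9 * \<kappa>) (2 + 2 / 9 * \<kappa>) < 0"
    unfolding eventually_at by auto
  define \<kappa> where "\<kappa> = 9/8 - min 1 \<delta> / 2"
  have \<kappa>: "\<kappa> > 0" "\<kappa> < 9/8" using \<delta>(1) by (auto simp: \<kappa>_def)
  have neg: "?E (2 - 16 / 9 * \<kappa>) (2 + 2 / 9 * \<kappa>) < 0"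
    using \<delta> by (intro \<delta>(2)) (auto simp: \<kappa>_def dist_real_def)
  define y where "y i = sqrt \<kappa> *\<^sub>R (i - (1/9) *\<^sub>R (\<Sum>j\<in>I. j))" for i
  have ij: "i \<bullet> j = (if i = j then 1 else 0)" if "i \<in> I" "j \<in> I" for i j
    using that I by (intro inner_Basis) auto
  have iS: "i \<bullet> (\<Sum>j\<in>I. j) = 1" "(\<Sum>j\<in>I. j) \<bullet> i = 1" if "i \<in> I" for i
    using that I by (simp_all add: inner_sum_right inner_sum_left ij inner_commute[of i])
  have SS: "(\<Sum>j\<in>I. j) \<bullet> (\<Sum>j\<in>I. j) = 9"
    using I by (simp add: inner_sum_left[of _ I "\<Sum>j\<in>I. j"] iS)
  have inner: "y i \<bullet> y j = (if i = j then 1 - (2 - 16 / 9 * \<kappa>) / 2 else 1 - (2 + 2 / 9 * \<kappa>) / 2)"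
    if "i \<in> I" "j \<in> I" for i j
  proof -
    have "y i \<bullet> y j = (sqrt \<kappa> * sqrt \<kappa>) * (i \<bullet> j - 1/9)"
      using that by (simp add: y_def inner_diff inner_scaleR_left inner_scaleR_right iS SS algebra_simps)
    then show ?thesis using \<kappa> ij[OF that] by (cases "i = j") (simp_all add: field_simps)
  qed
  have sum0: "(\<Sum>i\<in>I. y i) = 0"
    using I by (simp add: y_def scaleR_sum_right[symmetric] sum_subtractf sum_constant_scaleR)
  have nrm: "norm (y i) = sqrt (8 / 9 * \<kappa>)" if "i \<in> I" for i
    using inner[OF that that] by (simp add: norm_eq_sqrt_inner field_simps)
  show thesis
  proof (rule that[of I "sqrt (8 / 9 * \<kappa>)" y])
    show "finite I" "I \<noteq> {}" using I by auto
    show "sqrt (8 / 9 * \<kappa>) < 1" using \<kappa> by simp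
    show "neg_laplacian_pow 3 (\<lambda>x. bubble_sum I y (n / 2 - \<mu>) x powr ((n - 6) / (n - 2 * \<mu>))) 0 < 0"
      using neg_laplacian_pow_3_bubble_sum_powr[OF I(2) sum0 _ inner] \<kappa> neg n by simp
  qed (rule nrm)
qed

section \<open>Bounds for the curvature of order \<open>2m\<close>\<close>

lemma laplacian_bubble_powr:
  fixes y :: "'a::euclidean_space"
  assumes "norm y < 1"
  shows "laplacian (\<lambda>x. bubble_quad y x powr a) = (\<lambda>x.
    a * (2 * real DIM('a) + 4 * (a - 1)) * bubble_quad y x powr (a - 1)
    - 4 * (1 - (norm y)\<^sup>2) * a * (a - 1) * bubble_quad y x powr (a - 2))"
proof -
  have nz: "bubble_quad y x > 0" for x
    using assms by (rule bubble_quad_pos)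
  then have mono: "quad_monomial y y y b 0 0 = (\<lambda>x. bubble_quad y x powr b)" for b
    by (auto simp: quad_monomial_def less_imp_neq[symmetric])
  define e where "e = 2 * (1 - (norm y)\<^sup>2)"
  have e: "norm y ^ 2 = 1 - e / 2" "y \<bullet> y = 1 - e / 2"
    by (simp_all add: e_def power2_norm_eq_inner field_simps)
  have "laplacian (\<lambda>x. bubble_quad y x powr a) x =
      (2 * real DIM('a) + 4 * (a - 1)) * (a * bubble_quad y x powr (a - 1))
      - 2 * e * (a * (a - 1) * bubble_quad y x powr (a - 1 - 1))" for x
    using laplacian_quad_monomial[OF assms assms assms e(1) e(1) e(1) e(2) e(2) e(2), of a 0 0 x]
    unfolding mono by simp
  then show ?thesis by (auto simp: e_def)
qed

primrec bubble_const :: "real \<Rightarrow> real \<Rightarrow> nat \<Rightarrow> real" where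
  "bubble_const n r 0 = 1"
| "bubble_const n r (Suc k) = 4 * (1 - r\<^sup>2) * (n / 2 + real k) * (n / 2 - real k - 1) * bubble_const n r k"

lemma bubble_const_pos: "r \<ge> 0 \<Longrightarrow> r < 1 \<Longrightarrow> n > 2 * real k \<Longrightarrow> bubble_const n r k > 0"
proof (induction k)
  case (Suc k)
  then have "r\<^sup>2 < 1" by (simp add: abs_square_less_1)
  with Suc show ?case by simp
qed simp

text \<open>The Laplacian of a power of the quadratic has two terms. For the exponent \<open>k' + 1 - n/2\<close> they have the
  exponents \<open>k' - n/2\<close> and \<open>k' - 1 - n/2\<close>, to which the induction hypotheses for \<open>k'\<close> and for
  \<open>k' - 1\<close> apply. The second contribution needs one more Laplacian, and one of its two terms cancels the
  first contribution.\<close>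

lemma neg_laplacian_pow_bubble:
  fixes y :: "'a::euclidean_space"
  assumes y: "norm y < 1"
  shows "neg_laplacian_pow k (\<lambda>x. bubble_quad y x powr (real k - real DIM('a) / 2)) =
    (\<lambda>x. bubble_const (real DIM('a)) (norm y) k * bubble_quad y x powr (- real k - real DIM('a) / 2))"
proof (induction k rule: less_induct)
  case (less k)
  let ?n = "real DIM('a)" and ?q = "bubble_quad y" and ?c = "bubble_const (real DIM('a)) (norm y)"
  have sm: "Cinf_on UNIV (\<lambda>x. ?q x powr a)" for a
    using y by (intro Cinf_on_powr bubble_quad_smooth bubble_quad_pos) auto
  show ?case
  proof (cases k)
    case (Suc k')
    define a where "a = real k - ?n / 2"
    have step: "(\<lambda>x. - laplacian (\<lambda>x. ?q x powr a) x) = (\<lambda>x. (- 4 * real k' * a) * ?q x powr (real k' - ?n / 2)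
        + (4 * (1 - (norm y)\<^sup>2) * a * (a - 1)) * ?q x powr (a - 2))"
      unfolding laplacian_bubble_powr[OF y] by (rule ext) (simp add: a_def Suc algebra_simps)
    have first: "neg_laplacian_pow k' (\<lambda>x. ?q x powr (real k' - ?n / 2))
        = (\<lambda>x. ?c k' * ?q x powr (- real k' - ?n / 2))"
      using less.IH Suc by simp
    have "neg_laplacian_pow k (\<lambda>x. ?q x powr a) x = (- 4 * real k' * a) * (?c k' * ?q x powr (- real k' - ?n / 2))
        + (4 * (1 - (norm y)\<^sup>2) * a * (a - 1)) * neg_laplacian_pow k' (\<lambda>x. ?q x powr (a - 2)) x" for x
      unfolding Suc neg_laplacian_pow_Suc step
      by (simp only: neg_laplacian_pow_add neg_laplacian_pow_cmult Cinf_on_cmult sm open_UNIV first)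
    also have "\<dots> x = ?c k * ?q x powr (- real k - ?n / 2)" for x
    proof (cases k')
      case 0
      then show ?thesis using Suc by (simp add: a_def algebra_simps)
    next
      case (Suc j)
      define b where "b = - real j - ?n / 2"
      have "a - 2 = real j - ?n / 2" using Suc \<open>k = Suc k'\<close> by (simp add: a_def)
      then have "neg_laplacian_pow k' (\<lambda>x. ?q x powr (a - 2)) x
          = - laplacian (\<lambda>x. ?c j * ?q x powr b) x"
        using less.IH[of j] Suc \<open>k = Suc k'\<close> by (simp add: neg_laplacian_pow_Suc' b_def)
      also have "\<dots> = - ?c j * (b * (2 * ?n + 4 * (b - 1)) * ?q x powr (b - 1)
          - 4 * (1 - (norm y)\<^sup>2) * b * (b - 1) * ?q x powr (b - 2))"
        by (simp add: laplacian_cmult sm laplacian_bubble_powr[OF y])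
      finally have second: "neg_laplacian_pow k' (\<lambda>x. ?q x powr (a - 2)) x = \<dots>" .
      have e: "b - 1 = - real k' - ?n / 2" "b - 2 = - real k - ?n / 2"
        using Suc \<open>k = Suc k'\<close> by (simp_all add: b_def)
      have v: "b = - real j - ?n / 2" "a = real j + 2 - ?n / 2" "real k' = real j + 1"
        using Suc \<open>k = Suc k'\<close> by (simp_all add: b_def a_def)
      have c: "?c k' = 4 * (1 - (norm y)\<^sup>2) * (?n / 2 + real j) * (?n / 2 - real j - 1) * ?c j"
        "?c k = 4 * (1 - (norm y)\<^sup>2) * (?n / 2 + real k') * (?n / 2 - real k' - 1) * ?c k'"
        using Suc \<open>k = Suc k'\<close> by simp_all
      show ?thesis
        unfolding second e c unfolding v by algebra
    qed
    finally show ?thesis unfolding a_def by blast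
  qed simp
qed

text \<open>Both functions are comparable to \<open>1 + |x|\<^sup>2\<close>, because the centres stay away from the unit sphere.\<close>

lemma bubble_quad_comparable:
  assumes "r < 1"
  obtains K :: real where "K > 0"
    "\<And>y z x :: 'a::euclidean_space. norm y = r \<Longrightarrow> norm z = r \<Longrightarrow> bubble_quad y x \<le> K * bubble_quad z x"
proof (cases "r < 0")
  case True
  then show thesis using that[of 1] by (metis norm_ge_zero not_le zero_less_one)
next
  case False
  define \<delta> where "\<delta> = 1 - r\<^sup>2"
  have "r\<^sup>2 < 1" using False assms by (simp add: abs_square_less_1)
  then have \<delta>: "\<delta> > 0" by (simp add: \<delta>_def)
  show thesis
  proof (rule that[of "2 + 9 / \<delta>"])
    fix y z x :: 'a assume yz: "norm y = r" "norm z = r"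
    have "norm (x - y) \<le> norm (x - z) + norm (z - y)"
      using norm_triangle_ineq[of "x - z" "z - y"] by simp
    also have "norm (z - y) \<le> 2"
      using norm_triangle_ineq4[of z y] yz assms by simp
    finally have "(norm (x - y))\<^sup>2 \<le> (norm (x - z) + 2)\<^sup>2" by (intro power_mono) auto
    also have "\<dots> \<le> 2 * (norm (x - z))\<^sup>2 + 8"
      using zero_le_power2[of "norm (x - z) - 2"] by (simp add: power2_eq_square algebra_simps)
    finally have "bubble_quad y x \<le> 2 * (norm (x - z))\<^sup>2 + (8 + \<delta>)"
      by (simp add: bubble_quad_eq yz \<delta>_def)
    also have "\<dots> \<le> (2 + 9 / \<delta>) * ((norm (x - z))\<^sup>2 + \<delta>)"
    proof -
      have "0 \<le> 9 / \<delta> * (norm (x - z))\<^sup>2" using \<delta> by simp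
      then show ?thesis using \<delta> by (simp add: algebra_simps)
    qed
    finally show "bubble_quad y x \<le> (2 + 9 / \<delta>) * bubble_quad z x"
      by (simp add: bubble_quad_eq yz \<delta>_def)
  qed (use \<delta> in \<open>simp add: add_pos_pos\<close>)
qed

lemma average_bounds:
  assumes "finite I" "I \<noteq> {}" and "\<And>i. i \<in> I \<Longrightarrow> lo \<le> f i" "\<And>i. i \<in> I \<Longrightarrow> f i \<le> hi"
  shows "lo \<le> (\<Sum>i\<in>I. f i) / real (card I)" "(\<Sum>i\<in>I. f i) / real (card I) \<le> hi"
  using sum_bounded_below[of I lo f] sum_bounded_above[of I f hi] assms
  by (simp_all add: field_simps card_gt_0_iff)

text \<open>All bubbles of the average are replaced by one of them, at the cost of a constant.\<close>

lemma bubble_sum_bounds: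
  assumes I: "finite I" "I \<noteq> {}" "i0 \<in> I" and y: "\<And>i. i \<in> I \<Longrightarrow> norm (y i) < 1"
    and K: "K > 0" "\<And>i j x. i \<in> I \<Longrightarrow> j \<in> I \<Longrightarrow> bubble_quad (y i) x \<le> K * bubble_quad (y j) x"
    and s: "s > 0"
  shows "K powr (- s) * bubble_quad (y i0) x powr (- s) \<le> bubble_sum I y s x"
    and "bubble_sum I y s x \<le> K powr s * bubble_quad (y i0) x powr (- s)"
proof -
  have pos: "bubble_quad (y i) x > 0" if "i \<in> I" for i
    using y[OF that] by (rule bubble_quad_pos)
  have "K powr (- s) * bubble_quad (y i0) x powr (- s) \<le> bubble_quad (y i) x powr (- s)" if "i \<in> I" for i
  proof -
    have "(K * bubble_quad (y i0) x) powr (- s) \<le> bubble_quad (y i) x powr (- s)"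
      using that pos[OF that] K I s by (intro powr_mono2') auto
    then show ?thesis using K(1) pos[OF I(3)] by (simp add: powr_mult)
  qed
  moreover have "bubble_quad (y i) x powr (- s) \<le> K powr s * bubble_quad (y i0) x powr (- s)" if "i \<in> I" for i
  proof -
    have "(K * bubble_quad (y i) x) powr (- s) \<le> bubble_quad (y i0) x powr (- s)"
      using that pos[OF I(3)] K I s by (intro powr_mono2') auto
    then have "K powr s * (K powr (- s) * bubble_quad (y i) x powr (- s))
        \<le> K powr s * bubble_quad (y i0) x powr (- s)"
      using K(1) pos[OF that] by (intro mult_left_mono) (simp_all add: powr_mult)
    moreover have "K powr s * K powr (- s) = 1" using K(1) by (simp add: powr_minus)
    ultimately show ?thesis by (simp add: mult.assoc[symmetric])
  qed
  ultimately show "K powr (- s) * bubble_quad (y i0) x powr (- s) \<le> bubble_sum I y s x"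
    "bubble_sum I y s x \<le> K powr s * bubble_quad (y i0) x powr (- s)"
    unfolding bubble_sum_def using I by (auto intro!: average_bounds)
qed

definition bubble_factor :: "'a set \<Rightarrow> ('a \<Rightarrow> 'a) \<Rightarrow> real \<Rightarrow> 'a::euclidean_space \<Rightarrow> real" where
  "bubble_factor I y l x = bubble_sum I y l x powr (1 / l)"

lemma Q_curvature_bubble_factor:
  fixes y :: "'a::euclidean_space \<Rightarrow> 'a"
  assumes n: "n = real DIM('a)" "n > 2 * real m" and l: "l = n / 2 - real m"
    and I: "finite I" "I \<noteq> {}" and y: "\<And>i. i \<in> I \<Longrightarrow> norm (y i) = r" and r: "r < 1"
  shows "Q_curvature m (bubble_factor I y l) x = 1 / l * bubble_const n r m *
    (bubble_sum I y l x powr (- (n / 2 + real m) / l) * bubble_sum I y (n / 2 + real m) x)"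
proof -
  have "l > 0" using n l by simp
  have pos: "bubble_sum I y l x > 0" for x
    using y r I by (intro bubble_sum_pos) auto
  have pw: "bubble_factor I y l x powr s = bubble_sum I y l x powr (s / l)" for x s
    by (simp add: bubble_factor_def powr_powr)
  have one: "bubble_sum I y l x powr (l / l) = bubble_sum I y l x" for x
    using pos[of x] \<open>l > 0\<close> by simp
  have sm: "Cinf_on UNIV (\<lambda>x. bubble_quad (y i) x powr a)" if "i \<in> I" for i a
    using y[OF that] r by (intro Cinf_on_powr bubble_quad_smooth bubble_quad_pos) auto
  have dim: "DIM('a) > 2 * m" using n by linarith
  have "neg_laplacian_pow m (bubble_sum I y l) = (\<lambda>x. bubble_const n r m * bubble_sum I y (n / 2 + real m) x)"
  proof -
    have "neg_laplacian_pow m (\<lambda>x. bubble_quad (y i) x powr (- l))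
        = (\<lambda>x. bubble_const n r m * bubble_quad (y i) x powr (- (n / 2 + real m)))" if "i \<in> I" for i
      using neg_laplacian_pow_bubble[of "y i" m] y[OF that] r by (simp add: l n(1) algebra_simps)
    moreover have sum: "bubble_sum I y s = (\<lambda>x. inverse (real (card I)) * (\<Sum>i\<in>I. bubble_quad (y i) x powr (- s)))" for s
      by (rule ext) (simp add: bubble_sum_def divide_inverse mult.commute)
    ultimately have "neg_laplacian_pow m (bubble_sum I y l)
        = (\<lambda>x. inverse (real (card I)) * (\<Sum>i\<in>I. bubble_const n r m * bubble_quad (y i) x powr (- (n / 2 + real m))))"
      using I sm by (simp add: neg_laplacian_pow_cmult neg_laplacian_pow_sum Cinf_on_sum)
    then show ?thesis
      unfolding sum by (simp add: sum_distrib_left[symmetric] mult.left_commute)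
  qed
  moreover have "(n - 2 * real m) / 2 = l" "- (n + 2 * real m) / 2 = - (n / 2 + real m)"
    "2 / (n - 2 * real m) = 1 / l"
    using n(2) by (simp_all add: l field_simps)
  ultimately show ?thesis
    using dim unfolding Q_curvature_def Let_def n(1)[symmetric] by (simp only: pw one if_True) (simp add: mult_ac)
qed

text \<open>With \<open>s = n/2 + m\<close>, the two factors in \<open>Q_curvature_bubble_factor\<close> are comparable to \<open>q powr s\<close> and to
  \<open>q powr (- s)\<close> for the function \<open>q\<close> of one fixed centre.\<close>

lemma Q_curvature_bubble_factor_bounded:
  fixes y :: "'a::euclidean_space \<Rightarrow> 'a"
  assumes n: "n = real DIM('a)" "n > 2 * real m" and l: "l = n / 2 - real m"
    and I: "finite I" "I \<noteq> {}" and y: "\<And>i. i \<in> I \<Longrightarrow> norm (y i) = r" and r: "r < 1"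
  shows "\<exists>C>0. \<forall>x. inverse C \<le> Q_curvature m (bubble_factor I y l) x
    \<and> Q_curvature m (bubble_factor I y l) x \<le> C"
proof -
  obtain i0 where i0: "i0 \<in> I" using I by auto
  then have r0: "r \<ge> 0" using y[of i0] by auto
  obtain K where K: "K > 0" "\<And>y z x :: 'a. norm y = r \<Longrightarrow> norm z = r \<Longrightarrow> bubble_quad y x \<le> K * bubble_quad z x"
    using bubble_quad_comparable[OF r] by blast
  define s where "s = n / 2 + real m"
  have ls: "l > 0" "s > 0" using n l by (auto simp: s_def)
  note bd = bubble_sum_bounds[of I i0 y K, OF I i0 _ K(1) K(2)]
  define c where "c = 1 / l * bubble_const n r m"
  have c: "c > 0" using bubble_const_pos[OF r0 r n(2)] ls by (simp add: c_def)
  define A where "A = K powr (- s) * K powr (- s)"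
  have A: "A > 0" "K powr s * K powr s = inverse A" using K(1) by (auto simp: A_def powr_minus)
  have main: "A \<le> bubble_sum I y l x powr (- s / l) * bubble_sum I y s x"
    "bubble_sum I y l x powr (- s / l) * bubble_sum I y s x \<le> inverse A" for x
  proof -
    define q where "q = bubble_quad (y i0) x"
    have q: "q > 0" unfolding q_def using i0 y r by (intro bubble_quad_pos) auto
    have u: "K powr (- l) * q powr (- l) \<le> bubble_sum I y l x" "bubble_sum I y l x \<le> K powr l * q powr (- l)"
      unfolding q_def using y r ls by (auto intro!: bd)
    have w: "K powr (- s) * q powr (- s) \<le> bubble_sum I y s x" "bubble_sum I y s x \<le> K powr s * q powr (- s)"
      unfolding q_def using y r ls by (auto intro!: bd)
    have upos: "bubble_sum I y l x > 0" using I y r by (intro bubble_sum_pos) auto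
    have "bubble_sum I y l x powr (- s / l) \<ge> (K powr l * q powr (- l)) powr (- s / l)"
      using u upos ls by (intro powr_mono2') (auto simp: divide_nonpos_pos)
    also have "(K powr l * q powr (- l)) powr (- s / l) = K powr (- s) * q powr s"
      using ls K(1) q by (simp add: powr_mult powr_powr)
    finally have u1: "K powr (- s) * q powr s \<le> bubble_sum I y l x powr (- s / l)" .
    have "bubble_sum I y l x powr (- s / l) \<le> (K powr (- l) * q powr (- l)) powr (- s / l)"
      using u ls K(1) q by (intro powr_mono2') (auto simp: divide_nonpos_pos)
    also have "(K powr (- l) * q powr (- l)) powr (- s / l) = K powr s * q powr s"
      using ls K(1) q by (simp add: powr_mult powr_powr)
    finally have u2: "bubble_sum I y l x powr (- s / l) \<le> K powr s * q powr s" .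
    have qq: "q powr s * q powr (- s) = 1" using q by (simp add: powr_minus)
    have "A = (K powr (- s) * q powr s) * (K powr (- s) * q powr (- s))"
      unfolding A_def using qq by (simp add: mult_ac)
    also have "\<dots> \<le> bubble_sum I y l x powr (- s / l) * bubble_sum I y s x"
      using u1 w(1) by (intro mult_mono) auto
    finally show "A \<le> bubble_sum I y l x powr (- s / l) * bubble_sum I y s x" .
    have "bubble_sum I y l x powr (- s / l) * bubble_sum I y s x
        \<le> (K powr s * q powr s) * (K powr s * q powr (- s))"
      using u2 w order_trans[OF _ w(1), of 0] by (intro mult_mono) auto
    also have "\<dots> = inverse A" using qq A(2) by (simp add: mult_ac)
    finally show "bubble_sum I y l x powr (- s / l) * bubble_sum I y s x \<le> inverse A" .
  qed
  have Q: "Q_curvature m (bubble_factor I y l) x = c * (bubble_sum I y l x powr (- s / l) * bubble_sum I y s x)" for x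
    using Q_curvature_bubble_factor[OF n l I y r] by (simp add: c_def s_def)
  define C where "C = max (c * inverse A) (inverse (c * A))"
  have "C \<ge> inverse (c * A)" "c * A > 0" using c A by (auto simp: C_def)
  then have C: "C > 0" "inverse C \<le> c * A"
    using less_le_trans[OF positive_imp_inverse_positive[of "c * A"], of C]
      le_imp_inverse_le[of "inverse (c * A)" C]
    by (simp_all del: inverse_mult_distrib)
  have "inverse C \<le> Q_curvature m (bubble_factor I y l) x
    \<and> Q_curvature m (bubble_factor I y l) x \<le> C" for x
  proof
    show "inverse C \<le> Q_curvature m (bubble_factor I y l) x"
      unfolding Q using C(2) mult_left_mono[OF main(1)[of x], of c] c by linarith
    have "Q_curvature m (bubble_factor I y l) x \<le> c * inverse A"
      unfolding Q using mult_left_mono[OF main(2)[of x], of c] c by linarith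
    then show "Q_curvature m (bubble_factor I y l) x \<le> C" by (simp add: C_def)
  qed
  with C(1) show ?thesis by blast
qed

section \<open>Extension to the sphere\<close>

lemma stereographic_has_derivative:
  fixes p :: "'a::euclidean_space \<times> real"
  assumes "snd p \<noteq> 1"
  shows "(stereographic has_derivative
    (\<lambda>u. fst u /\<^sub>R (1 - snd p) + (snd u / (1 - snd p)\<^sup>2) *\<^sub>R fst p)) (at p)"
proof -
  have "((\<lambda>p::'a \<times> real. 1 - snd p) has_derivative (\<lambda>u. 0 - snd u)) (at p)"
    by (intro has_derivative_diff has_derivative_const has_derivative_snd has_derivative_ident)
  moreover have "1 - snd p \<noteq> 0" using assms by simp
  ultimately have "((\<lambda>p::'a \<times> real. inverse (1 - snd p)) has_derivative
      (\<lambda>u. - (inverse (1 - snd p) * (0 - snd u) * inverse (1 - snd p)))) (at p)"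
    by (rule Deriv.has_derivative_inverse[rotated])
  from has_derivative_scaleR[OF this has_derivative_fst[OF has_derivative_ident]]
  show ?thesis
    unfolding stereographic_def[abs_def]
    by (rule has_derivative_eq_rhs) (auto simp: power2_eq_square divide_inverse mult_ac)
qed

lemma snd_less_1_on_sphere:
  fixes p :: "'a::euclidean_space \<times> real"
  assumes "p \<in> sphere 0 1 - {pole}"
  shows "snd p < 1"
proof -
  have p: "fst p \<bullet> fst p + snd p * snd p = 1"
    using assms by (cases p) (simp add: norm_eq_1)
  then have "snd p * snd p \<le> 1" using inner_ge_zero[of "fst p"] by linarith
  then have "snd p \<le> 1" by (metis abs_le_square_iff abs_le_D1 abs_one one_power2 power2_eq_square)
  moreover have "snd p \<noteq> 1"
    using assms p by (cases p) (auto simp: pole_def)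
  ultimately show ?thesis by simp
qed

lemma stereographic_conformal:
  fixes p u v :: "'a::euclidean_space \<times> real"
  assumes p: "p \<in> sphere 0 1 - {pole}" and u: "u \<in> tangent_sphere p" and v: "v \<in> tangent_sphere p"
  shows "frechet_derivative stereographic (at p) u \<bullet> frechet_derivative stereographic (at p) v
    = (u \<bullet> v) / (1 - snd p)\<^sup>2"
proof -
  define \<tau> where "\<tau> = 1 - snd p"
  have \<tau>: "\<tau> > 0" "snd p = 1 - \<tau>" using snd_less_1_on_sphere[OF p] by (simp_all add: \<tau>_def)
  have D: "frechet_derivative stereographic (at p) w = inverse \<tau> *\<^sub>R fst w + (snd w / \<tau>\<^sup>2) *\<^sub>R fst p" for w
    using dir_deriv_eq[OF stereographic_has_derivative, of p w] \<tau>(1)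
    by (simp add: dir_deriv_def \<tau>_def)
  have zz: "fst p \<bullet> fst p = \<tau> * (2 - \<tau>)"
    using p by (cases p) (simp add: norm_eq_1 \<tau>_def algebra_simps)
  have zu: "fst p \<bullet> fst u = - (1 - \<tau>) * snd u" and zv: "fst p \<bullet> fst v = - (1 - \<tau>) * snd v"
    using u v by (simp_all add: tangent_sphere_def inner_prod_def \<tau>_def)
  have "frechet_derivative stereographic (at p) u \<bullet> frechet_derivative stereographic (at p) v
      = (fst u \<bullet> fst v) / \<tau>\<^sup>2 + (snd v * (fst p \<bullet> fst u) + snd u * (fst p \<bullet> fst v)) / (\<tau> * \<tau>\<^sup>2)
        + snd u * snd v * (fst p \<bullet> fst p) / (\<tau>\<^sup>2 * \<tau>\<^sup>2)"
    unfolding D by (simp add: inner_add_left inner_add_right inner_commute[of "fst u" "fst p"]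
        divide_inverse power2_eq_square algebra_simps)
  also have "\<dots> = (u \<bullet> v) / \<tau>\<^sup>2"
    unfolding zz zu zv inner_prod_def using \<tau>(1) by (simp add: divide_simps power2_eq_square) algebra
  finally show ?thesis by (simp add: \<tau>_def)
qed

text \<open>The terms quadratic in the point of the sphere combine to a multiple of \<open>1 - snd p\<close>, which is why the
  numerator is affine.\<close>

lemma bubble_quad_stereographic:
  fixes p :: "'a::euclidean_space \<times> real"
  assumes "p \<in> sphere 0 1 - {pole}"
  shows "bubble_quad y (stereographic p) = (2 - 2 * (fst p \<bullet> y)) / (1 - snd p)"
proof -
  have s: "1 - snd p > 0" using snd_less_1_on_sphere[OF assms] by simp
  have p: "fst p \<bullet> fst p = (1 - snd p) * (1 + snd p)"
    using assms by (cases p) (simp add: norm_eq_1 algebra_simps)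
  show ?thesis
    unfolding bubble_quad_def stereographic_def using s
    by (simp add: p divide_simps)
qed

text \<open>The average of bubbles as a function on the ambient space of the sphere, without the conformal
  factor of the projection.\<close>

definition sphere_sum :: "'a set \<Rightarrow> ('a \<Rightarrow> 'a) \<Rightarrow> real \<Rightarrow> 'a::euclidean_space \<times> real \<Rightarrow> real" where
  "sphere_sum I y l p = (\<Sum>i\<in>I. (2 - 2 * (fst p \<bullet> y i)) powr (- l)) / real (card I)"

lemma bubble_sum_stereographic:
  fixes p :: "'a::euclidean_space \<times> real"
  assumes p: "p \<in> sphere 0 1 - {pole}" and y: "\<And>i. i \<in> I \<Longrightarrow> norm (y i) < 1"
  shows "bubble_sum I y l (stereographic p) = (1 - snd p) powr l * sphere_sum I y l p"
proof -
  have s: "1 - snd p > 0" using snd_less_1_on_sphere[OF p] by simp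
  have "bubble_quad (y i) (stereographic p) powr (- l)
      = (1 - snd p) powr l * (2 - 2 * (fst p \<bullet> y i)) powr (- l)" if "i \<in> I" for i
  proof -
    have "0 < bubble_quad (y i) (stereographic p)" using y[OF that] by (rule bubble_quad_pos)
    then have "2 - 2 * (fst p \<bullet> y i) > 0"
      unfolding bubble_quad_stereographic[OF p] using s by (simp add: zero_less_divide_iff)
    then show ?thesis
      unfolding bubble_quad_stereographic[OF p] using s
      by (simp add: powr_divide powr_minus divide_simps)
  qed
  then show ?thesis
    by (simp add: bubble_sum_def sphere_sum_def sum_distrib_left)
qed

text \<open>The powers of \<open>1 - snd p\<close> from \<open>bubble_sum_stereographic\<close> and from \<open>stereographic_conformal\<close> cancel,
  so the pullback is \<open>sphere_sum powr (2 / l)\<close> times the round metric. The affine functions in this sum are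
  positive on an open set that contains the whole sphere, in particular near the pole.\<close>

lemma extends_to_sphere_bubble_factor:
  fixes y :: "'a::euclidean_space \<Rightarrow> 'a"
  assumes I: "finite I" "I \<noteq> {}" and y: "\<And>i. i \<in> I \<Longrightarrow> norm (y i) < 1" and l: "l > 0"
  shows "extends_to_sphere (conf_metric (bubble_factor I y l))"
proof -
  define W :: "('a \<times> real) set" where "W = {p. \<forall>i\<in>I. 0 < 2 - 2 * (fst p \<bullet> y i)}"
  have W: "open W"
  proof -
    have "W = (\<Inter>i\<in>I. {p. 0 < 2 - 2 * (fst p \<bullet> y i)})" by (auto simp: W_def)
    moreover have "open {p::'a \<times> real. 0 < 2 - 2 * (fst p \<bullet> y i)}" for i
      by (intro open_Collect_less continuous_intros)
    ultimately show ?thesis using I by auto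
  qed
  have sphere_W: "sphere 0 1 \<subseteq> W"
  proof
    fix p :: "'a \<times> real" assume "p \<in> sphere 0 1"
    then have "norm (fst p) \<le> 1" using norm_fst_le[of "fst p" "snd p"] by simp
    then have "fst p \<bullet> y i < 1" if "i \<in> I" for i
      using Cauchy_Schwarz_ineq2[of "fst p" "y i"] y[OF that] mult_right_mono[OF _ norm_ge_zero, of "norm (fst p)" 1 "y i"]
      by linarith
    then show "p \<in> W" by (auto simp: W_def)
  qed
  have pos: "sphere_sum I y l p > 0" if "p \<in> W" for p
    unfolding sphere_sum_def using I that
    by (intro divide_pos_pos sum_pos) (auto simp: card_gt_0_iff W_def less_le)
  have affine: "Cinf_on W (\<lambda>p. 2 - 2 * (fst p \<bullet> z))" for z
    using W
    by (intro Cinf_on_diff Cinf_on_cmult Cinf_on_inner Cinf_on_const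
        Cinf_on_bounded_linear[OF bounded_linear_fst])
  have smooth: "Cinf_on W (\<lambda>p. sphere_sum I y l p powr (2 / l))"
    using W pos unfolding sphere_sum_def divide_inverse
    by (intro Cinf_on_powr Cinf_on_mult Cinf_on_sum affine Cinf_on_const) (auto simp: W_def)
  define h where "h p u v = sphere_sum I y l p powr (2 / l) * (u \<bullet> v)" for p u v :: "'a \<times> real"
  have "smooth_sphere_metric h"
    unfolding smooth_sphere_metric_def
  proof (intro conjI ballI allI impI)
    fix p :: "'a \<times> real" assume "p \<in> sphere 0 1"
    then have "sphere_sum I y l p powr (2 / l) > 0" using pos sphere_W by fastforce
    then show "inner_product_on (tangent_sphere p) (h p)"
      unfolding inner_product_on_def h_def
      by (auto simp: inner_commute inner_add_left algebra_simps)
  next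
    fix X Y :: "'a \<times> real \<Rightarrow> 'a \<times> real" assume "smooth_tangent_field X" "smooth_tangent_field Y"
    then have XY: "smooth_on_subset (sphere 0 1) X" "smooth_on_subset (sphere 0 1) Y"
      by (auto simp: smooth_tangent_field_def)
    show "smooth_on_subset (sphere 0 1) (\<lambda>p. h p (X p) (Y p))"
      unfolding smooth_on_subset_def
    proof
      fix p :: "'a \<times> real" assume p: "p \<in> sphere 0 1"
      obtain A F where F: "open A" "p \<in> A" "Cinf_on A F" "\<forall>q\<in>sphere 0 1 \<inter> A. F q = X q"
        using XY(1) p unfolding smooth_on_subset_def by metis
      obtain B G where G: "open B" "p \<in> B" "Cinf_on B G" "\<forall>q\<in>sphere 0 1 \<inter> B. G q = Y q"
        using XY(2) p unfolding smooth_on_subset_def by metis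
      let ?V = "A \<inter> B \<inter> W"
      have "Cinf_on ?V (\<lambda>q. h q (F q) (G q))"
        unfolding h_def using F(1) G(1) W
        by (intro Cinf_on_mult Cinf_on_inner Cinf_on_subset[OF smooth] Cinf_on_subset[OF F(3)]
            Cinf_on_subset[OF G(3)]) auto
      then show "\<exists>V H. open V \<and> p \<in> V \<and> Cinf_on V H
          \<and> (\<forall>q\<in>sphere 0 1 \<inter> V. H q = h q (X q) (Y q))"
        using F G W p sphere_W
        by (intro exI[of _ ?V] exI[of _ "\<lambda>q. h q (F q) (G q)"]) auto
    qed
  qed
  moreover have "h p u v = stereographic_pullback (conf_metric (bubble_factor I y l)) p u v"
    if p: "p \<in> sphere 0 1 - {pole}" and uv: "u \<in> tangent_sphere p" "v \<in> tangent_sphere p" for p u v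
  proof -
    have s: "1 - snd p > 0" using snd_less_1_on_sphere[OF p] by simp
    have S: "sphere_sum I y l p > 0" using pos sphere_W p by blast
    have B: "bubble_sum I y l (stereographic p) = (1 - snd p) powr l * sphere_sum I y l p"
      using p y by (rule bubble_sum_stereographic)
    have "(bubble_factor I y l (stereographic p))\<^sup>2
        = (1 - snd p)\<^sup>2 * sphere_sum I y l p powr (2 / l)"
      using s S l unfolding bubble_factor_def B
      by (simp add: powr_mult powr_powr power_mult_distrib powr_power)
    then show ?thesis
      using s by (simp add: stereographic_pullback_def conf_metric_def h_def stereographic_conformal[OF p uv])
  qed
  ultimately show ?thesis unfolding extends_to_sphere_def by blast
qed

section \<open>The size of the largest root\<close>

lemma real_poly_root_greater:
  fixes p :: "real poly"
  assumes "poly p a < 0" and "lead_coeff p > 0"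
  shows "\<exists>r>a. poly p r = 0"
proof -
  obtain b where b: "\<forall>x\<ge>b. lead_coeff p \<le> poly p x"
    using poly_pinfty_gt_lc[OF assms(2)] by blast
  then have "poly p (max b (a + 1)) > 0"
    using assms(2) by (meson less_le_trans max.cobounded1)
  then show ?thesis
    using poly_IVT_pos[of a "max b (a + 1)" p] assms(1) by force
qed

lemma poly_gamma_poly:
  "poly (gamma_poly m) x = x^5 - 19 * (real m - 1) * x^4 + (117 * real m^2 - 212 * real m + 92) * x^3
    - (337 * real m^3 - 851 * real m^2 + 652 * real m - 140) * x^2
    + 2 * (real m - 1) * (241 * real m^3 - 518 * real m^2 + 264 * real m - 24) * x
    - 4 * real m * (real m - 1) * (70 * real m^3 - 187 * real m^2 + 133 * real m - 24)"
  by (simp add: gamma_poly_def Let_def eval_nat_numeral algebra_simps)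

text \<open>The leading coefficient is positive, so there is a root to the right of \<open>x\<close>.\<close>

lemma less_N_root:
  assumes "m \<ge> 4" and "poly (gamma_poly m) x < 0"
  shows "x < N_root m"
proof -
  have "lead_coeff (gamma_poly m) > 0" by (simp add: gamma_poly_def Let_def)
  then obtain r where "r > x" "poly (gamma_poly m) r = 0"
    using real_poly_root_greater assms(2) by blast
  then show ?thesis using N_root(2)[OF assms(1)] by force
qed

text \<open>In the variable \<open>m - 4\<close> all coefficients of \<open>\<gamma>\<^sub>m(10 m - 11)\<close> are negative.\<close>

lemma N_root_lower_bound:
  assumes "m \<ge> 4"
  shows "10 * real m - 11 < N_root m"
proof (rule less_N_root[OF assms])
  define p where "p = real m - 4"
  have p: "real m = p + 4" "p \<ge> 0" using assms by (auto simp: p_def)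
  have "poly (gamma_poly m) (10 * real m - 11)
      = - (2160*p^5 + 25514*p^4 + 113853*p^3 + 230144*p^2 + 187521*p + 23540)"
    unfolding poly_gamma_poly p(1) by algebra
  also have "\<dots> < 0"
    unfolding neg_less_0_iff_less using p(2)
    by (intro add_nonneg_pos add_nonneg_nonneg mult_nonneg_nonneg zero_le_power) auto
  finally show "poly (gamma_poly m) (10 * real m - 11) < 0" .
qed

abbreviation Lambda_quartic :: "real \<Rightarrow> real" where
  "Lambda_quartic X \<equiv> X^4 - 17 * X^3 + 83 * X^2 - 171 * X + 140"

lemma poly_Lambda_quartic: "poly [:140, - 171, 83, - 17, 1:] X = Lambda_quartic X"
  by (simp add: eval_nat_numeral algebra_simps)

lemma less_Lambda_const: "Lambda_quartic X < 0 \<Longrightarrow> X < Lambda_const"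
proof -
  assume "Lambda_quartic X < 0"
  then have "poly [:140, - 171, 83, - 17, 1:] X < 0" by (simp only: poly_Lambda_quartic)
  then obtain r where "r > X" "poly [:140, - 171, 83, - 17, 1:] r = 0"
    using real_poly_root_greater by fastforce
  then show ?thesis using Lambda_const(2) by force
qed

lemma Lambda_const_bounds: "10.545 < Lambda_const" "Lambda_const < 10.555"
proof -
  show "10.545 < Lambda_const" by (rule less_Lambda_const) (simp add: power_numeral_reduce)
  have "Lambda_quartic X > 0" if "X \<ge> 10.555" for X
  proof -
    define h where "h = X - 2111/200"
    have h: "X = h + 2111/200" "h \<ge> 0" using that by (auto simp: h_def)
    have "Lambda_quartic X = h^4 + 1261/50 * h^3 + 4262863/20000 * h^2 + 1205935081/2000000 * h
        + 5136229641/1600000000"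
      unfolding h(1) by algebra
    also have "\<dots> > 0" using h(2)
      by (intro add_nonneg_pos add_nonneg_nonneg mult_nonneg_nonneg zero_le_power) auto
    finally show ?thesis .
  qed
  then show "Lambda_const < 10.555"
    using Lambda_const(1) unfolding poly_Lambda_quartic by (metis less_irrefl not_le)
qed

text \<open>Expanded at 10, the quartic polynomial has only one negative coefficient, the constant one; so it increases
  to the right of 10 up to its zero \<open>\<Lambda>\<close>.\<close>

lemma Lambda_quartic_neg:
  assumes "10 \<le> X" and "X < Lambda_const"
  shows "Lambda_quartic X < 0"
proof -
  have shift: "Lambda_quartic Y = (Y - 10)^4 + 23 * (Y - 10)^3 + 173 * (Y - 10)^2 + 389 * (Y - 10) - 270" for Y
    by algebra
  have "Lambda_quartic X < Lambda_quartic Lambda_const"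
    unfolding shift using assms
    by (intro diff_strict_right_mono add_strict_mono mult_strict_left_mono power_strict_mono) auto
  then show ?thesis using Lambda_const(1) unfolding poly_Lambda_quartic by simp
qed

lemma poly_gamma_poly_scaled:
  "poly (gamma_poly m) (X * real m) = real m^5 * ((X - 2) * Lambda_quartic X)
    + real m^4 * (19*X^4 - 212*X^3 + 851*X^2 - 1518*X + 1028)
    + real m^3 * (92*X^3 - 652*X^2 + 1564*X - 1280)
    + real m^2 * (140*X^2 - 576*X + 628) + real m * (48*X - 96)"
  unfolding poly_gamma_poly by algebra

text \<open>For \<open>X \<ge> \<Lambda>\<close> all coefficients in \<open>poly_gamma_poly_scaled\<close> are nonnegative, and those below
  the leading one are positive; the latter is seen by expanding them at \<open>21/2 < \<Lambda>\<close>.\<close>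

lemma N_root_less:
  assumes m: "m \<ge> 4"
  shows "N_root m < Lambda_const * real m"
proof (rule ccontr)
  assume "\<not> N_root m < Lambda_const * real m"
  define X where "X = N_root m / real m"
  have X: "X \<ge> Lambda_const" "N_root m = X * real m"
    using \<open>\<not> _\<close> m by (auto simp: X_def field_simps)
  have "Lambda_quartic X \<ge> 0" using less_Lambda_const[of X] X by force
  then have "real m^5 * ((X - 2) * Lambda_quartic X) \<ge> 0"
    using X(1) Lambda_const_bounds by (intro mult_nonneg_nonneg) auto
  define h where "h = X - 21/2"
  have h: "X = h + 21/2" "h \<ge> 0" using X(1) Lambda_const_bounds by (auto simp: h_def)
  have "19*X^4 - 212*X^3 + 851*X^2 - 1518*X + 1028
      = 19*h^4 + 586*h^3 + 13483/2*h^2 + 68427/2*h + 1031063/16"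
    "92*X^3 - 652*X^2 + 1564*X - 1280 = 92*h^3 + 2246*h^2 + 18301*h + 99521/2"
    "140*X^2 - 576*X + 628 = 140*h^2 + 2364*h + 10015"
    unfolding h(1) by algebra+
  moreover have "\<dots> > 0" "92*h^3 + 2246*h^2 + 18301*h + 99521/2 > 0"
    "19*h^4 + 586*h^3 + 13483/2*h^2 + 68427/2*h + 1031063/16 > 0"
    using h(2) by (intro add_nonneg_pos add_nonneg_nonneg mult_nonneg_nonneg zero_le_power; simp)+
  ultimately have lower: "19*X^4 - 212*X^3 + 851*X^2 - 1518*X + 1028 > 0"
    "92*X^3 - 652*X^2 + 1564*X - 1280 > 0" "140*X^2 - 576*X + 628 > 0" "48*X - 96 > 0"
    using h by simp_all
  have "poly (gamma_poly m) (X * real m) > 0"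
    unfolding poly_gamma_poly_scaled using m lower \<open>real m^5 * _ \<ge> 0\<close>
    by (intro add_pos_pos add_nonneg_pos mult_pos_pos) auto
  then show False using N_root(1)[OF m] X(2) by simp
qed

text \<open>The negative leading term in \<open>poly_gamma_poly_scaled\<close> dominates for large \<open>m\<close>.\<close>

lemma eventually_less_N_root:
  assumes "10 \<le> X" and "X < Lambda_const"
  shows "eventually (\<lambda>m. X * real m < N_root m) sequentially"
proof -
  define K where "K = (X - 2) * Lambda_quartic X"
  have K: "K < 0" using Lambda_quartic_neg[OF assms] assms by (auto simp: K_def mult_pos_neg)
  define A4 A3 A2 A1 where "A4 = 19*X^4 - 212*X^3 + 851*X^2 - 1518*X + 1028"
    and "A3 = 92*X^3 - 652*X^2 + 1564*X - 1280" and "A2 = 140*X^2 - 576*X + 628" and "A1 = 48*X - 96"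
  have "eventually (\<lambda>m. real m > (\<bar>A4\<bar> + \<bar>A3\<bar> + \<bar>A2\<bar> + \<bar>A1\<bar>) / - K) sequentially"
    by (rule eventually_gt_at_top[THEN filterlim_real_sequentially[unfolded filterlim_iff, rule_format]])
  then show ?thesis using eventually_ge_at_top[of 4]
  proof eventually_elim
    case (elim m)
    define \<mu> where "\<mu> = real m"
    have \<mu>: "\<mu> \<ge> 1" using elim by (simp add: \<mu>_def)
    have le: "\<mu> ^ j * A \<le> \<mu> ^ 4 * \<bar>A\<bar>" if "j \<le> 4" for j A
    proof -
      have "\<mu> ^ j * A \<le> \<mu> ^ j * \<bar>A\<bar>" using \<mu> by (intro mult_left_mono) auto
      also have "\<dots> \<le> \<mu> ^ 4 * \<bar>A\<bar>"
        using that \<mu> by (intro mult_right_mono power_increasing) auto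
      finally show ?thesis .
    qed
    have "\<mu>^5 * K + \<mu>^4 * A4 + \<mu>^3 * A3 + \<mu>^2 * A2 + \<mu> * A1
        \<le> \<mu>^5 * K + \<mu>^4 * \<bar>A4\<bar> + \<mu>^4 * \<bar>A3\<bar> + \<mu>^4 * \<bar>A2\<bar> + \<mu>^4 * \<bar>A1\<bar>"
      using le[of 4 A4] le[of 3 A3] le[of 2 A2] le[of 1 A1] by simp
    also have "\<dots> = \<mu>^4 * (\<mu> * K + (\<bar>A4\<bar> + \<bar>A3\<bar> + \<bar>A2\<bar> + \<bar>A1\<bar>))" by algebra
    also have "\<dots> < 0"
      using elim(1) K \<mu> by (intro mult_pos_neg) (auto simp: \<mu>_def field_simps)
    finally have "poly (gamma_poly m) (X * real m) < 0"
      unfolding poly_gamma_poly_scaled K_def A4_def A3_def A2_def A1_def \<mu>_def .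
    then show ?case by (rule less_N_root[OF elim(2)])
  qed
qed

lemma N_root_asymptotic: "(\<lambda>m. N_root m / (Lambda_const * real m)) \<longlonglongrightarrow> 1"
proof (rule order_tendstoI)
  have L: "Lambda_const > 10" using Lambda_const_bounds by simp
  fix a :: real assume "a < 1"
  define X where "X = max 10 (a * Lambda_const)"
  have "10 \<le> X" "X < Lambda_const" using L \<open>a < 1\<close> by (auto simp: X_def)
  then have "eventually (\<lambda>m. X * real m < N_root m) sequentially" by (rule eventually_less_N_root)
  then show "eventually (\<lambda>m. a < N_root m / (Lambda_const * real m)) sequentially"
    using eventually_gt_at_top[of 0]
  proof eventually_elim
    case (elim m)
    have "a * Lambda_const * real m \<le> X * real m" by (intro mult_right_mono) (auto simp: X_def)
    then have "a * (Lambda_const * real m) < N_root m" using elim(1) by (simp add: mult.assoc)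
    then show ?case using elim(2) L by (simp add: pos_less_divide_eq)
  qed
next
  have L: "Lambda_const > 10" using Lambda_const_bounds by simp
  fix a :: real assume "a > 1"
  show "eventually (\<lambda>m. N_root m / (Lambda_const * real m) < a) sequentially"
    using eventually_ge_at_top[of 4]
  proof eventually_elim
    case (elim m)
    have "N_root m / (Lambda_const * real m) < 1" using N_root_less[OF elim] L elim by simp
    then show ?case using \<open>a > 1\<close> by simp
  qed
qed

section \<open>Existence of the metric\<close>

theorem theorem1p2:
  shows "(\<forall>m::nat. m \<ge> 4 \<longrightarrow> real CARD('n::finite) > N_root m \<longrightarrow>
            (\<exists>\<phi> :: real ^ 'n \<Rightarrow> real.
               Cinf_on UNIV \<phi> \<and> (\<forall>x. \<phi> x > 0) \<and>
               Q_curvature 3 \<phi> 0 < 0 \<and>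
               (\<exists>C>0. \<forall>x. inverse C \<le> Q_curvature m \<phi> x \<and> Q_curvature m \<phi> x \<le> C) \<and>
               extends_to_sphere (conf_metric \<phi>)))
       \<and> (\<lambda>m. N_root m / (Lambda_const * real m)) \<longlonglongrightarrow> 1
       \<and> (\<forall>m::nat. m \<ge> 4 \<longrightarrow> N_root m < Lambda_const * real m)
       \<and> \<bar>Lambda_const - 10.55\<bar> < 0.005"
proof (intro conjI allI impI)
  fix m :: nat assume m: "m \<ge> 4" and N: "real CARD('n) > N_root m"
  define n where "n = real DIM(real ^ 'n)"
  have n: "n > 10 * real m - 11" using N_root_lower_bound[OF m] N by (simp add: n_def)
  define l where "l = n / 2 - real m"
  have l: "l > 0" "n > 2 * real m" "n > 6" using n m by (auto simp: l_def)
  have hyps: "4 \<le> real m" "10 * real m - 11 \<le> n" using m n by auto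
  obtain I and y :: "real ^ 'n \<Rightarrow> real ^ 'n" and r where I: "finite I" "I \<noteq> {}" and r: "r < 1"
    and y: "\<And>i. i \<in> I \<Longrightarrow> norm (y i) = r"
    and neg: "neg_laplacian_pow 3 (\<lambda>x. bubble_sum I y l x powr ((n - 6) / (n - 2 * real m))) 0 < 0"
    unfolding l_def by (rule exists_simplex[OF n_def hyps]) blast
  have y1: "norm (y i) < 1" if "i \<in> I" for i using y[OF that] r by simp
  let ?\<phi> = "bubble_factor I y l"
  have pos: "bubble_sum I y l x > 0" for x using I y1 by (rule bubble_sum_pos)
  show "\<exists>\<phi> :: real ^ 'n \<Rightarrow> real.
      Cinf_on UNIV \<phi> \<and> (\<forall>x. \<phi> x > 0) \<and> Q_curvature 3 \<phi> 0 < 0 \<and>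
      (\<exists>C>0. \<forall>x. inverse C \<le> Q_curvature m \<phi> x \<and> Q_curvature m \<phi> x \<le> C) \<and>
      extends_to_sphere (conf_metric \<phi>)"
  proof (intro exI[of _ ?\<phi>] conjI allI)
    show "Cinf_on UNIV ?\<phi>"
      unfolding bubble_factor_def[abs_def] using pos y1 by (intro Cinf_on_powr bubble_sum_smooth) auto
    show "?\<phi> x > 0" for x using pos[of x] by (simp add: bubble_factor_def)
    have "1 / l * ((n - 2 * real 3) / 2) = (n - 6) / (n - 2 * real m)"
      using l(2) by (simp add: l_def field_simps)
    then have pw: "(\<lambda>x. ?\<phi> x powr ((n - 2 * real 3) / 2))
        = (\<lambda>x. bubble_sum I y l x powr ((n - 6) / (n - 2 * real m)))"
      by (simp only: bubble_factor_def powr_powr)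
    have "DIM(real ^ 'n) > 2 * 3" using l(3) by (simp add: n_def)
    then have Q: "Q_curvature 3 ?\<phi> 0 = 2 / (n - 2 * real 3) * ?\<phi> 0 powr (- (n + 2 * real 3) / 2) *
        neg_laplacian_pow 3 (\<lambda>x. ?\<phi> x powr ((n - 2 * real 3) / 2)) 0"
      unfolding Q_curvature_def Let_def n_def[symmetric] by (simp only: if_True)
    have "2 / (n - 2 * real 3) * ?\<phi> 0 powr (- (n + 2 * real 3) / 2) > 0"
      using pos[of 0] l(3) by (simp add: bubble_factor_def)
    then show "Q_curvature 3 ?\<phi> 0 < 0"
      unfolding Q pw using neg by (rule mult_pos_neg)
    show "\<exists>C>0. \<forall>x. inverse C \<le> Q_curvature m ?\<phi> x \<and> Q_curvature m ?\<phi> x \<le> C"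
      using n_def l(2) l_def I y r by (rule Q_curvature_bubble_factor_bounded)
    show "extends_to_sphere (conf_metric ?\<phi>)"
      using I y1 l(1) by (rule extends_to_sphere_bubble_factor)
  qed
next
  show "(\<lambda>m. N_root m / (Lambda_const * real m)) \<longlonglongrightarrow> 1" by (rule N_root_asymptotic)
  show "N_root m < Lambda_const * real m" if "m \<ge> 4" for m using that by (rule N_root_less)
  show "\<bar>Lambda_const - 10.55\<bar> < 0.005"
    unfolding abs_less_iff using Lambda_const_bounds by (intro conjI) simp_all
qed

end
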